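(* For each $n$, there exists a set of $n$ points on the $2$-sphere with at least $\frac{17}{4}n-O(\sqrt{n})$ double-normal pairs as $n\to\infty$; that is, there are constants $C>0$ and $n_0$ such that for every integer $n\geq n_0$ there exists a set $V$ of $n$ points on the $2$-sphere with $N(V)\geq\frac{17}{4}n-C\sqrt{n}$. Moreover, for infinitely many values of $n$, there exists a set of $n$ points on the $2$-sphere with exactly $\frac{17}{4}n-6$ double-normal pairs.
   Context: The $2$-sphere is the round unit sphere in $\mathbb{R}^3$, and its subsets are regarded as subsets of $\mathbb{R}^3$. For a finite set $V$ of points in $\mathbb{R}^3$, a double-normal pair of $V$ is an (unordered) pair $\{p,q\}$ of distinct points of $V$ such that $V$ lies in the closed strip bounded by the planes through $p$ and $q$, respectively, that are perpendicular to the segment $pq$. $N(V)$ denotes the number of double-normal pairs of $V$. *)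

theory Defs
  imports "HOL-Analysis.Analysis"
begin

(* The planes through p and q perpendicular to the segment pq are the level sets of
   (\<lambda>x. x \<bullet> (q - p)) at the values p \<bullet> (q - p) < q \<bullet> (q - p)
   (for p \<noteq> q). *)
definition closed_strip :: "real^3 \<Rightarrow> real^3 \<Rightarrow> (real^3) set" where
  "closed_strip p q = {x. p \<bullet> (q - p) \<le> x \<bullet> (q - p) \<and> x \<bullet> (q - p) \<le> q \<bullet> (q - p)}"

definition double_normal_pairs :: "(real^3) set \<Rightarrow> (real^3) set set" where
  "double_normal_pairs V = {{p, q} | p q. p \<in> V \<and> q \<in> V \<and> p \<noteq> q \<and> V \<subseteq> closed_strip p q}"

definition num_double_normal_pairs :: "(real^3) set \<Rightarrow> nat" where
  "num_double_normal_pairs V = card (double_normal_pairs V)"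

end

theory Submission
  imports Defs
begin

text \<open>
  For unit vectors \<open>p\<close>, \<open>q\<close> and \<open>b = - q\<close>, a point \<open>x\<close> of the sphere lies in the strip of \<open>p\<close>, \<open>q\<close>
  iff neither \<open>x\<close> nor \<open>- x\<close> is interior to the ball with diameter \<open>p b\<close>. So the double-normal pairs
  of a centrally symmetric set are, up to antipodes, the edges of its Gabriel graph.

  Take regular polygons with \<open>2 h, 4 h, 8 h, \<dots>, 2\<^sup>s\<^sup>+\<^sup>1 h\<close> vertices, all with the same side length, on
  circles of latitude, descending from the north pole, together with their mirror images in the
  equatorial plane. Every side of a polygon spans a rectangle with a parallel side of the next one
  (for the last polygon: with its mirror image), and the gaps are triangles. Both diagonals of each
  rectangle are Gabriel edges, and all vertices except those of the two top polygons are in three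
  rectangles; for \<open>h = 2\<close> the top polygons are squares, hence rectangles as well, and the count
  \<open>17 n / 4 - 6\<close> is exact. For arbitrary \<open>n\<close> one takes \<open>h\<close> and \<open>2\<^sup>s\<close> of order \<open>\<surd>n\<close> and adds
  \<open>O(\<surd>n)\<close> further points close to the north pole, which destroy no pair.
\<close>

subsection \<open>Regular polygons on circles of latitude\<close>

text \<open>Reducing \<open>l\<close> modulo \<open>m\<close> brings the angle into one full turn,
  and the reflection x -> 2 pi - x keeps it an odd multiple of \<open>pi / m\<close>. The gap
  between \<open>pi / m\<close> and \<open>3 * (pi / m)\<close> is exploited in
  \<open>side_ineq\<close>.\<close>

lemma odd_multiple_cases:
  fixes m l :: int
  assumes "m > 0"
  obtains t where "pi / m \<le> t" "t \<le> pi" "t = pi / m \<or> 3 * (pi / m) \<le> t"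
    "cos ((2 * l + 1) * (pi / m)) = cos t" "\<bar>sin ((2 * l + 1) * (pi / m))\<bar> = sin t"
proof -
  define l0 where "l0 = l mod m"
  define x0 where "x0 = (2 * l0 + 1) * (pi / m)"
  have l0: "0 \<le> l0" "l0 < m"
    using assms by (auto simp: l0_def)
  have l: "l = l0 + m * (l div m)"
    by (simp add: l0_def)
  have "real_of_int (2 * l + 1) * (pi / m) = x0 + 2 * pi * of_int (l div m)"
    unfolding x0_def using assms by (subst l) (simp add: field_simps)
  then have x: "cos ((2 * l + 1) * (pi / m)) = cos x0" "sin ((2 * l + 1) * (pi / m)) = sin x0"
    by (simp_all add: cos_add sin_add)
  have base: "pi / m \<le> (2 * k + 1) * (pi / m)
      \<and> ((2 * k + 1) * (pi / m) = pi / m \<or> 3 * (pi / m) \<le> (2 * k + 1) * (pi / m))"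
    if "k \<ge> 0" for k :: int
  proof (cases "k = 0")
    case False
    with that have "real_of_int k \<ge> 1" by linarith
    then have "3 * (pi / m) \<le> (2 * k + 1) * (pi / m)"
      using assms by (intro mult_right_mono) auto
    moreover have "pi / m \<ge> 0" using assms by simp
    ultimately show ?thesis by linarith
  qed simp
  show thesis
  proof (cases "x0 \<le> pi")
    case True
    have "x0 \<ge> 0" unfolding x0_def using l0 assms by simp
    then show thesis
      using that[of x0] base[OF l0(1)] True x by (auto simp: x0_def sin_ge_zero)
  next
    case False
    define k where "k = m - 1 - l0"
    have k: "k \<ge> 0" using l0 by (simp add: k_def)
    have eq: "2 * pi - x0 = (2 * k + 1) * (pi / m)"
      using assms by (simp add: x0_def k_def field_simps)
    then have nn: "2 * pi - x0 \<ge> 0"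
      using k assms by simp
    have "sin (2 * pi - x0) \<ge> 0"
      using nn False by (intro sin_ge_zero) auto
    moreover have "cos (2 * pi - x0) = cos x0" "sin (2 * pi - x0) = - sin x0"
      by (simp_all add: cos_diff sin_diff)
    ultimately show thesis
      using that[of "2 * pi - x0"] base[OF k] False x unfolding eq[symmetric] by auto
  qed
qed

lemma cos_odd_multiple_le:
  fixes m l :: int
  assumes "m > 0"
  shows "cos ((2 * l + 1) * (pi / m)) \<le> cos (pi / m)"
proof -
  obtain t where "pi / m \<le> t" "t \<le> pi" "cos ((2 * l + 1) * (pi / m)) = cos t"
    using odd_multiple_cases[OF assms, of l] by metis
  then show ?thesis
    using assms by (simp add: cos_monotone_0_pi_le)
qed

text \<open>With \<open>h_ge\<close> the smallest polygon has at least four vertices, hence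
  \<open>\<theta> j \<le> pi / 4\<close> on every ring.\<close>

locale ring_configuration =
  fixes h s :: nat
  assumes h_ge: "2 \<le> h"
begin

definition ring_size :: "nat \<Rightarrow> int" where
  "ring_size j = int h * 2 ^ Suc j"

text \<open>Half the central angle of a side.\<close>

definition \<theta> :: "nat \<Rightarrow> real" where
  "\<theta> j = pi / ring_size j"

text \<open>Half the common side length of all the polygons, chosen such that \<open>rad s = 1 / 2\<close>.\<close>
definition q :: real where
  "q = sin (\<theta> s) / 2"

text \<open>The circumradius of the regular polygon with half side \<open>q\<close>;
  \<open>apo\<close> is its apothem, the horizontal distance from the axis to a side.\<close>

definition rad :: "nat \<Rightarrow> real" where
  "rad j = q / sin (\<theta> j)"

definition apo :: "nat \<Rightarrow> real" where
  "apo j = rad j * cos (\<theta> j)"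

definition ht :: "nat \<Rightarrow> real" where
  "ht j = sqrt (1 - (rad j)\<^sup>2)"

text \<open>With vertices at odd multiples of \<open>\<theta> j\<close>, sides are centred at even
  ones. As \<open>\<theta> j = 2 * \<theta> (Suc j)\<close>, each side of a ring is centred above a
  side of the next ring (a rectangle), and each vertex above the midpoint of another side (a
  triangle).\<close>

definition ang :: "nat \<Rightarrow> int \<Rightarrow> real" where
  "ang j k = (2 * k + 1) * \<theta> j"

definition pt :: "nat \<Rightarrow> int \<Rightarrow> real \<Rightarrow> real^3" where
  "pt j k \<sigma> = vector [rad j * cos (ang j k), rad j * sin (ang j k), \<sigma> * ht j]"

definition points :: "(real^3) set" where
  "points = {pt j k \<sigma> | j k \<sigma>. j \<le> s \<and> \<sigma> \<in> {1, -1}}"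

section \<open>Relations between the angles, radii, apothems and heights\<close>

lemma ring_size_pos: "ring_size j > 0"
  using h_ge by (simp add: ring_size_def)

lemma ring_size_Suc: "ring_size (Suc j) = 2 * ring_size j"
  by (simp add: ring_size_def)

lemma ring_size_ge: "ring_size j \<ge> 4"
proof -
  have "int 2 * 2 ^ 1 \<le> int h * 2 ^ Suc j"
    using h_ge by (intro mult_mono power_increasing) auto
  then show ?thesis by (simp add: ring_size_def)
qed

lemma \<theta>_Suc: "\<theta> j = 2 * \<theta> (Suc j)"
  by (simp add: \<theta>_def ring_size_Suc)

lemma \<theta>_add: "\<theta> j = 2 ^ n * \<theta> (j + n)"
  by (simp add: \<theta>_def ring_size_def power_add)

lemma ring_size_\<theta>: "ring_size j * \<theta> j = pi"
  using ring_size_pos[of j] by (simp add: \<theta>_def)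

lemma \<theta>_pos: "\<theta> j > 0"
  using ring_size_pos by (simp add: \<theta>_def)

lemma \<theta>_le: "\<theta> j \<le> pi / 4"
  unfolding \<theta>_def using ring_size_ge[of j] by (intro divide_left_mono) auto

lemma \<theta>_antimono: "i \<le> j \<Longrightarrow> \<theta> j \<le> \<theta> i"
proof (rule lift_Suc_antimono_le[of \<theta>])
  show "\<theta> (Suc n) \<le> \<theta> n" for n
    using \<theta>_Suc[of n] \<theta>_pos[of "Suc n"] by linarith
qed

lemma \<theta>_strict: "i < j \<Longrightarrow> \<theta> j < \<theta> i"
  using \<theta>_antimono[of "Suc i" j] \<theta>_Suc[of i] \<theta>_pos[of "Suc i"] by simp

lemma sin_\<theta>_pos: "sin (\<theta> j) > 0"
  using \<theta>_pos[of j] \<theta>_le[of j] pi_gt_zero by (intro sin_gt_zero) linarith+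

lemma cos_\<theta>_pos: "cos (\<theta> j) > 0"
  using \<theta>_pos[of j] \<theta>_le[of j] pi_gt_zero by (intro cos_gt_zero_pi) linarith+

lemma q_pos: "q > 0"
  using sin_\<theta>_pos by (simp add: q_def)

lemma rad_pos: "rad j > 0"
  using q_pos sin_\<theta>_pos by (simp add: rad_def)

lemma rad_sin: "rad j * sin (\<theta> j) = q"
  using sin_\<theta>_pos[of j] by (simp add: rad_def)

lemma apo_pos: "apo j > 0"
  using rad_pos cos_\<theta>_pos by (simp add: apo_def)

lemma rad_sq: "(rad j)\<^sup>2 = (apo j)\<^sup>2 + q\<^sup>2"
proof -
  have "(rad j)\<^sup>2 = (rad j)\<^sup>2 * ((cos (\<theta> j))\<^sup>2 + (sin (\<theta> j))\<^sup>2)"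
    by simp
  also have "\<dots> = (apo j)\<^sup>2 + (rad j * sin (\<theta> j))\<^sup>2"
    by (simp only: apo_def power_mult_distrib distrib_left)
  finally show ?thesis by (simp add: rad_sin)
qed

text \<open>This is the half-angle formula for the cotangent.\<close>
lemma apo_Suc: "apo (Suc j) = apo j + rad j"
proof -
  define t where "t = \<theta> (Suc j)"
  have t: "sin t > 0" "cos t > 0"
    by (simp_all add: t_def sin_\<theta>_pos cos_\<theta>_pos)
  have "apo j + rad j = q * (1 + cos (2 * t)) / sin (2 * t)"
    unfolding apo_def rad_def \<theta>_Suc[of j] t_def[symmetric] by (simp add: add_divide_distrib distrib_left)
  also have "\<dots> = q * (2 * (cos t)\<^sup>2) / (2 * sin t * cos t)"
    unfolding cos_double_cos sin_double by simp
  also have "\<dots> = apo (Suc j)"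
    using t by (simp add: apo_def rad_def power2_eq_square flip: t_def)
  finally show ?thesis by simp
qed

lemma apo_ge_q: "q \<le> apo j"
proof -
  have "tan (\<theta> j) \<le> tan (pi / 4)"
    using \<theta>_le[of j] \<theta>_pos[of j] by (intro tan_mono_le) auto
  then have "sin (\<theta> j) \<le> cos (\<theta> j)"
    using cos_\<theta>_pos[of j] unfolding tan_45 by (simp add: tan_def divide_le_eq)
  then have "rad j * sin (\<theta> j) \<le> apo j"
    unfolding apo_def using rad_pos[of j] by (intro mult_left_mono) auto
  then show ?thesis by (simp add: rad_sin)
qed

lemma apo_less_rad: "apo j < rad j"
  by (rule power_less_imp_less_base[of _ 2]) (use rad_sq[of j] q_pos rad_pos[of j] in auto)

lemma apo_mono: "i \<le> j \<Longrightarrow> apo i \<le> apo j"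
  by (rule lift_Suc_mono_le[of apo]) (auto simp: apo_Suc less_imp_le[OF rad_pos])

lemma rad_mono:
  assumes "i \<le> j"
  shows "rad i \<le> rad j"
proof -
  have "(apo i)\<^sup>2 \<le> (apo j)\<^sup>2"
    using apo_mono[OF assms] apo_pos[of i] by (intro power_mono) auto
  then have "(rad i)\<^sup>2 \<le> (rad j)\<^sup>2"
    by (simp add: rad_sq)
  then show ?thesis
    by (rule power2_le_imp_le) (simp add: less_imp_le rad_pos)
qed

lemma rad_strict: "i < j \<Longrightarrow> rad i < rad j"
  using apo_mono[of "Suc i" j] apo_Suc[of i] apo_pos[of i] apo_less_rad[of j] by simp

lemma rad_s: "rad s = 1 / 2"
  using sin_\<theta>_pos[of s] by (simp add: rad_def q_def)

lemma rad_le: "j \<le> s \<Longrightarrow> rad j \<le> 1 / 2"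
  using rad_mono[of j s] rad_s by simp

lemma rad_sq_less: "j \<le> s \<Longrightarrow> (rad j)\<^sup>2 < 1"
  using rad_le[of j] rad_pos[of j] power_strict_mono[of "rad j" 1 2] by simp

lemma ht_sq: "j \<le> s \<Longrightarrow> (ht j)\<^sup>2 = 1 - (rad j)\<^sup>2"
  using rad_sq_less[of j] by (simp add: ht_def)

lemma ht_pos: "j \<le> s \<Longrightarrow> ht j > 0"
  using rad_sq_less[of j] by (simp add: ht_def)

lemma ht_less_1: "ht j < 1"
  using rad_pos[of j] by (simp add: ht_def)

lemma ht_strict: "i < j \<Longrightarrow> ht j < ht i"
  using rad_strict[of i j] rad_pos[of i] by (simp add: ht_def power_strict_mono)

lemma ht_antimono: "i \<le> j \<Longrightarrow> ht j \<le> ht i"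
  using ht_strict[of i j] by (cases "i = j") auto

lemma rad_minus_apo: "(rad i - apo i) * apo (Suc i) = q\<^sup>2"
  using rad_sq[of i] by (simp add: apo_Suc algebra_simps power2_eq_square)

text \<open>By \<open>apo_ge_q\<close>, \<open>rad i\<close> is at most sqrt 2 times
  \<open>apo i\<close>, and sqrt 2 < 3 / 2.\<close>

lemma rad_minus_apo_le: "rad i - apo i \<le> rad i / 3"
proof -
  have "q\<^sup>2 \<le> (apo i)\<^sup>2"
    using apo_ge_q q_pos by (intro power_mono) auto
  then have "(2 * rad i)\<^sup>2 \<le> (3 * apo i)\<^sup>2"
    using rad_sq[of i] by (simp add: power_mult_distrib, use zero_le_power2[of "apo i"] in linarith)
  then show ?thesis
    using power2_le_imp_le[of "2 * rad i" "3 * apo i"] apo_pos[of i] by simp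
qed

lemma rad_le_apo_add: "rad i \<le> apo i + q"
  by (rule power2_le_imp_le) (use rad_sq[of i] q_pos apo_pos[of i] in \<open>auto simp: power2_sum\<close>)

lemma rad_le_apo: "i < j \<Longrightarrow> rad i + apo i \<le> apo j"
  using apo_mono[of "Suc i" j] by (simp add: apo_Suc)

text \<open>The next three inequalities, which do not involve the heights, say that the spherical cap
  belonging to an edge stays clear of whole circles of latitude.\<close>
lemma cap_ineq_above:
  assumes "i < j"
  shows "(rad i - apo i) * (apo j + apo (Suc j)) \<le> (apo j - apo i) * (apo (Suc j) - apo i)"
proof -
  define A where "A = apo j - apo i"
  have A: "A \<ge> rad i" using rad_le_apo[OF assms] by (simp add: A_def)
  have rj: "apo i \<le> rad j"
    using rad_mono[of i j] apo_less_rad[of i] assms by simp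
  have d: "apo i \<le> A" using A apo_less_rad[of i] by simp
  have "rad i - apo i \<le> A / 3"
    using rad_minus_apo_le[of i] A by simp
  then have "(rad i - apo i) * (apo j + apo (Suc j)) \<le> A / 3 * (apo j + apo (Suc j))"
    using apo_pos[of j] apo_pos[of "Suc j"] by (intro mult_right_mono) auto
  \<comment> \<open>The second factor equals \<open>2 * A + 2 * apo i + rad j\<close>, and
    \<open>apo i\<close> is at most \<open>A\<close> and at most \<open>rad j\<close>.\<close>
  also have "\<dots> \<le> A / 3 * (3 * (A + rad j))"
    using rj d A rad_pos[of i] by (intro mult_left_mono) (auto simp: A_def apo_Suc)
  also have "\<dots> = A * (A + rad j)"
    by simp
  also have "\<dots> = (apo j - apo i) * (apo (Suc j) - apo i)"
    by (simp add: A_def apo_Suc algebra_simps)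
  finally show ?thesis .
qed

lemma cap_ineq_ring:
  assumes "i < j"
  shows "(rad i - apo i) * (2 * apo j) \<le> (apo j - apo i)\<^sup>2"
proof -
  define A where "A = apo j - apo i"
  define d where "d = apo i"
  define r where "r = rad i"
  have A: "A \<ge> r" using rad_le_apo[OF assms] by (simp add: A_def r_def)
  have r: "r > 0" using rad_pos by (simp add: r_def)
  have d: "2 * d - r \<ge> 0"
    using rad_minus_apo_le[of i] rad_pos[of i] by (simp add: r_def d_def)
  have rd: "r\<^sup>2 \<le> 2 * d\<^sup>2"
    using rad_sq[of i] power_mono[OF apo_ge_q[of i], of 2] q_pos by (simp add: r_def d_def)
  \<comment> \<open>Expanded, this is just \<open>rd\<close>. Afterwards \<open>r\<close> is
    replaced by the larger \<open>A\<close>, which increases both nonnegative factors.\<close>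
  have "2 * d * (r - d) \<le> r * (r - 2 * (r - d))"
    using rd by (simp add: algebra_simps power2_eq_square)
  also have "\<dots> \<le> A * (A - 2 * (r - d))"
    using A d r by (intro mult_mono) auto
  finally have "(r - d) * (2 * (A + d)) \<le> A\<^sup>2"
    by (simp add: algebra_simps power2_eq_square)
  then show ?thesis by (simp add: A_def d_def r_def)
qed

lemma cap_ineq_below:
  assumes "Suc j < i"
  shows "(rad i - apo i) * (apo j + apo (Suc j)) + 2 * q\<^sup>2 * rad i / (apo j + apo (Suc j))
    \<le> 2 * q\<^sup>2 + (apo i - apo j) * (apo i - apo (Suc j))"
proof -
  \<comment> \<open>The first term will be at most \<open>q\<^sup>2\<close> by
    \<open>rad_minus_apo\<close>, and the fraction at most \<open>2 * q\<^sup>2 + q * y\<close>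
    because \<open>rad i \<le> H + y\<close> and \<open>3 * q \<le> H\<close>. What remains is
    \<open>q\<^sup>2 + q * y \<le> y * (y + rad j)\<close>, where
    \<open>y + rad j = apo i - apo j\<close>.\<close>
  define y where "y = apo i - apo (Suc j)"
  define H where "H = apo j + apo (Suc j)"
  have y: "apo j + rad j \<le> y"
    using rad_le_apo[OF assms] apo_less_rad[of "Suc j"] apo_Suc[of j] by (simp add: y_def)
  have q: "0 < q" "q \<le> apo j" "q \<le> rad j"
    using q_pos apo_ge_q[of j] apo_less_rad[of j] by auto
  have H: "H > 0" "3 * q \<le> H"
    using q apo_Suc[of j] by (auto simp: H_def)
  have "H \<le> apo (Suc i)"
    using y q apo_Suc[of j] apo_Suc[of i] rad_pos[of i] by (simp add: H_def y_def)
  then have 1: "(rad i - apo i) * H \<le> q\<^sup>2"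
    unfolding rad_minus_apo[of i, symmetric] using apo_less_rad[of i] by (intro mult_left_mono) auto
  have "rad i \<le> H + y"
    using rad_le_apo_add[of i] q by (simp add: H_def y_def)
  then have "2 * q\<^sup>2 * rad i / H \<le> 2 * q\<^sup>2 * (H + y) / H"
    using H q by (intro divide_right_mono mult_left_mono) auto
  also have "\<dots> = 2 * q\<^sup>2 + 2 * q\<^sup>2 * y / H"
    using H by (simp add: add_divide_distrib distrib_left)
  also have "\<dots> \<le> 2 * q\<^sup>2 + q * y"
  proof -
    have "2 * q\<^sup>2 * y / H \<le> 2 * q\<^sup>2 * y / (3 * q)"
      using H q y by (intro divide_left_mono) auto
    also have "\<dots> \<le> q * y"
      using q y by (simp add: power2_eq_square)
    finally show ?thesis by simp
  qed
  finally have 2: "2 * q\<^sup>2 * rad i / H \<le> 2 * q\<^sup>2 + q * y" .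
  have "q\<^sup>2 + q * y \<le> q * y + q * y"
    using q y by (simp add: power2_eq_square)
  also have "\<dots> \<le> y * y + rad j * y"
    using q y by (intro add_mono mult_right_mono) auto
  also have "\<dots> = (apo i - apo j) * (apo i - apo (Suc j))"
    by (simp add: y_def apo_Suc[of j] algebra_simps)
  finally show ?thesis
    using 1 2 by (simp add: H_def)
qed

end

subsection \<open>Gabriel edges of the configuration\<close>

text \<open>For unit \<open>x\<close> the inequality says (x - a) \<bullet> (x - b) \<ge> 0, so no
  point of \<open>X\<close> on the sphere is interior to the ball with diameter
  \<open>a b\<close>.\<close>

definition gabriel :: "'a::real_inner set \<Rightarrow> 'a \<Rightarrow> 'a \<Rightarrow> bool" where
  "gabriel X a b \<longleftrightarrow> (\<forall>x\<in>X. x \<bullet> (a + b) \<le> 1 + a \<bullet> b)"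

lemma gabriel_commute: "gabriel X a b \<longleftrightarrow> gabriel X b a"
  by (simp add: gabriel_def add.commute inner_commute)

lemma inner_vector_3:
  "(vector [a, b, c] :: real^3) \<bullet> vector [a', b', c'] = a * a' + b * b' + c * c'"
  by (simp add: inner_vec_def sum_3)

text \<open>The left side is at most sqrt (H^2 + 4 q^2), and the bound is the tangent estimate of
  this root. The proof adds two squares and uses that the squares of sine and cosine sum to
  1.\<close>

lemma cos_sin_le:
  fixes H q g :: real
  assumes "H > 0" "q \<ge> 0"
  shows "H * cos g + 2 * q * \<bar>sin g\<bar> \<le> H + 2 * q\<^sup>2 / H"
proof -
  define A c where "A = \<bar>sin g\<bar>" and "c = cos g"
  have "A\<^sup>2 = 1 - c\<^sup>2"
    by (simp add: A_def c_def sin_squared_eq)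
  then have "H\<^sup>2 * A\<^sup>2 = H\<^sup>2 * (1 - c\<^sup>2)" by simp
  moreover have "0 \<le> (2 * q - H * A)\<^sup>2" "0 \<le> H\<^sup>2 * (1 - c)\<^sup>2" by simp_all
  ultimately have "H * (H * c + 2 * q * A) \<le> H * H + 2 * q\<^sup>2"
    by (simp add: power2_diff power_mult_distrib algebra_simps power2_eq_square)
  then show ?thesis
    using assms by (simp add: A_def c_def field_simps power2_eq_square)
qed

lemma sin_le_sin_cases:
  assumes "sin u \<le> sin t" "0 \<le> t" "t \<le> pi / 2" "t < u"
  shows "pi - t \<le> u"
proof (rule ccontr)
  assume "\<not> pi - t \<le> u"
  show False
  proof (cases "u \<le> pi / 2")
    case True
    then have "sin t < sin u"
      using assms by (intro sin_monotone_2pi) auto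
    then show False using assms by simp
  next
    case False
    then have "sin t < sin (pi - u)"
      using assms \<open>\<not> pi - t \<le> u\<close> by (intro sin_monotone_2pi) auto
    then show False using assms by simp
  qed
qed

context ring_configuration
begin

section \<open>Scalar products of the points, and rings seen from the symmetry plane of a
  side\<close>

lemma pt_inner:
  "pt i k \<sigma> \<bullet> pt j l \<tau> = rad i * rad j * cos (ang i k - ang j l) + \<sigma> * \<tau> * ht i * ht j"
  by (simp add: pt_def inner_vector_3 cos_diff algebra_simps)

lemma pt_in_points: "j \<le> s \<Longrightarrow> \<sigma> \<in> {1, -1} \<Longrightarrow> pt j k \<sigma> \<in> points"
  by (auto simp: points_def)

lemma apo_ht_sq: "j \<le> s \<Longrightarrow> (apo j)\<^sup>2 + (ht j)\<^sup>2 = 1 - q\<^sup>2"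
  by (simp add: ht_sq rad_sq)

lemma pt_sphere: "j \<le> s \<Longrightarrow> \<sigma> \<in> {1, -1} \<Longrightarrow> pt j k \<sigma> \<bullet> pt j k \<sigma> = 1"
  using ht_sq[of j] by (auto simp: pt_inner power2_eq_square)

lemma ang_Suc: "ang j (k + 1) = ang j k + 2 * \<theta> j"
  by (simp add: ang_def algebra_simps)

lemma rad_sq_cos: "rad j * rad j * cos (2 * \<theta> j) = (rad j)\<^sup>2 - 2 * q\<^sup>2"
proof -
  have "rad j * rad j * cos (2 * \<theta> j) = (rad j)\<^sup>2 - 2 * (rad j * sin (\<theta> j))\<^sup>2"
    unfolding cos_double_sin by (simp add: algebra_simps power2_eq_square)
  then show ?thesis by (simp add: rad_sin)
qed

lemma sign_ht_le:
  assumes "\<sigma> \<in> {1, -1}" "\<tau> \<in> {1, -1}" "i \<le> s" "c \<ge> 0"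
  shows "\<tau> * \<sigma> * ht i * c \<le> ht i * c"
  using assms ht_pos[of i] by auto

lemma ang_centre:
  assumes "j \<le> i"
  obtains p :: int where "ang i l - 2 * of_int \<kappa> * \<theta> j = (2 * of_int p + 1) * (pi / ring_size i)"
proof
  have "\<theta> j = 2 ^ (i - j) * \<theta> i"
    using \<theta>_add[of j "i - j"] assms by simp
  then show "ang i l - 2 * of_int \<kappa> * \<theta> j
      = (2 * of_int (l - \<kappa> * 2 ^ (i - j)) + 1) * (pi / ring_size i)"
    unfolding \<theta>_def[of i, symmetric] by (simp add: ang_def algebra_simps)
qed

text \<open>A side centre of ring \<open>j\<close> is also the azimuth of a side centre of each
  larger ring \<open>i\<close>, and the polygon does not extend beyond the line of that
  side.\<close>

lemma rad_cos_centre_le: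
  assumes "j \<le> i"
  shows "rad i * cos (ang i l - 2 * of_int \<kappa> * \<theta> j) \<le> apo i"
proof -
  obtain p :: int where "ang i l - 2 * of_int \<kappa> * \<theta> j = (2 * of_int p + 1) * (pi / ring_size i)"
    using ang_centre[OF assms] .
  then show ?thesis
    unfolding apo_def using cos_odd_multiple_le[OF ring_size_pos[of i], of p] rad_pos[of i]
    by (intro mult_left_mono) (simp_all add: \<theta>_def)
qed

lemma rad_cos_le: "rad i * cos g \<le> rad i"
  using rad_pos[of i] mult_left_mono[of "cos g" 1 "rad i"] by simp

lemma gabriel_refl:
  assumes "j \<le> s" "\<sigma> \<in> {1, -1}"
  shows "gabriel points (pt j k \<sigma>) (pt j k \<sigma>)"
  unfolding gabriel_def
proof
  fix x assume "x \<in> points"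
  then have "norm x = 1"
    using pt_sphere by (auto simp: points_def norm_eq_1)
  moreover have "norm (pt j k \<sigma>) = 1"
    using pt_sphere[OF assms] by (simp add: norm_eq_1)
  ultimately have "x \<bullet> pt j k \<sigma> \<le> 1"
    using norm_cauchy_schwarz[of x "pt j k \<sigma>"] by simp
  then show "x \<bullet> (pt j k \<sigma> + pt j k \<sigma>) \<le> 1 + pt j k \<sigma> \<bullet> pt j k \<sigma>"
    unfolding inner_add_right pt_sphere[OF assms] by simp
qed

lemma gabriel_ring:
  assumes "j \<le> s" "\<sigma> \<in> {1, -1}"
  shows "gabriel points (pt j k \<sigma>) (pt j (k + 1) \<sigma>)"
  unfolding gabriel_def
proof
  fix x assume "x \<in> points"
  then obtain i l \<tau> where x: "x = pt i l \<tau>" "i \<le> s" "\<tau> \<in> {1, -1}"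
    by (auto simp: points_def)
  define g where "g = ang i l - 2 * of_int (k + 1) * \<theta> j"
  define X where "X = rad i * cos g"
  have g: "ang i l - ang j k = g + \<theta> j" "ang i l - ang j (k + 1) = g - \<theta> j"
    by (simp_all add: g_def ang_def algebra_simps)
  have "x \<bullet> (pt j k \<sigma> + pt j (k + 1) \<sigma>) = 2 * X * apo j + 2 * (\<tau> * \<sigma> * ht i * ht j)"
    unfolding x inner_add_right pt_inner g
    by (simp add: cos_add cos_diff X_def apo_def algebra_simps)
  also have "\<dots> \<le> 2 * X * apo j + 2 * (ht i * ht j)"
    using sign_ht_le[of \<sigma> \<tau> i "ht j"] assms x ht_pos[of j] by simp
  also have "\<dots> \<le> 2 - 2 * q\<^sup>2"
  proof -
    \<comment> \<open>All vectors (\<open>apo\<close>, \<open>ht\<close>) have squared length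
      \<open>1 - q\<^sup>2\<close>. The square of the difference of apothems is kept because
      \<open>cap_ineq_ring\<close> consumes it when ring \<open>i\<close> lies above.\<close>
    have sq: "2 * (apo i * apo j + ht i * ht j) + (apo i - apo j)\<^sup>2 \<le> 2 - 2 * q\<^sup>2"
      using apo_ht_sq[OF assms(1)] apo_ht_sq[OF x(2)] zero_le_power2[of "ht i - ht j"]
      by (simp add: power2_diff)
    show ?thesis
    proof (cases "j \<le> i")
      case True
      then have "X \<le> apo i"
        using rad_cos_centre_le[of j i l "k + 1"] by (simp add: X_def g_def)
      then have "X * apo j \<le> apo i * apo j"
        using apo_pos[of j] by (intro mult_right_mono) auto
      moreover have "2 * (apo i * apo j + ht i * ht j) \<le> 2 - 2 * q\<^sup>2"
        using sq zero_le_power2[of "apo i - apo j"] by linarith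
      ultimately show ?thesis by (simp add: algebra_simps)
    next
      case False
      have "X * (2 * apo j) \<le> rad i * (2 * apo j)"
        using apo_pos[of j] rad_cos_le by (intro mult_right_mono) (auto simp: X_def)
      then show ?thesis
        using cap_ineq_ring[of i j] False sq by (simp add: power2_commute algebra_simps)
    qed
  qed
  also have "\<dots> = 1 + pt j k \<sigma> \<bullet> pt j (k + 1) \<sigma>"
    using assms rad_sq_cos[of j] ht_sq[OF assms(1)]
    by (auto simp: pt_inner ang_Suc power2_eq_square)
  finally show "x \<bullet> (pt j k \<sigma> + pt j (k + 1) \<sigma>) \<le> 1 + pt j k \<sigma> \<bullet> pt j (k + 1) \<sigma>" .
qed

section \<open>The sides and diagonals of the rectangles between consecutive rings\<close>

lemma side_ineq:
  fixes i j :: nat and l \<kappa> :: int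
  assumes "i = j \<or> i = Suc j"
  defines "g \<equiv> ang i l - 2 * of_int \<kappa> * \<theta> j" and "H \<equiv> apo j + apo (Suc j)"
  shows "rad i * cos g * H + 2 * q * \<bar>rad i * sin g\<bar> \<le> apo i * H + 2 * q\<^sup>2"
proof -
  have ji: "j \<le> i" using assms(1) by auto
  obtain p :: int where p: "g = (2 * of_int p + 1) * (pi / ring_size i)"
    unfolding g_def using ang_centre[OF ji] .
  obtain t where t: "\<theta> i \<le> t" "t \<le> pi" "t = \<theta> i \<or> 3 * \<theta> i \<le> t"
    "cos g = cos t" "\<bar>sin g\<bar> = sin t"
    by (rule odd_multiple_cases[OF ring_size_pos[of i], of p], rule that) (simp_all add: p \<theta>_def)
  \<comment> \<open>The extremal vertex is at \<open>t = \<theta> i\<close>. For any other one,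
    sum-to-product formulas reduce the claim to tan Y \<ge> 2 q / H for the mean angle
    \<open>Y\<close>. This holds since \<open>Y\<close> is at least \<open>2 * \<theta> i\<close>,
    hence at least \<open>\<theta> j\<close>, whose tangent is \<open>q / apo j\<close>.\<close>
  have "H * (cos t - cos (\<theta> i)) + 2 * q * (sin t - sin (\<theta> i)) \<le> 0"
  proof (cases "t = \<theta> i")
    case False
    define Y where "Y = (t + \<theta> i) / 2"
    define Z where "Z = (t - \<theta> i) / 2"
    have tYZ: "t = Y + Z" "\<theta> i = Y - Z"
      by (simp_all add: Y_def Z_def field_simps)
    have diff: "cos t - cos (\<theta> i) = - 2 * sin Y * sin Z" "sin t - sin (\<theta> i) = 2 * cos Y * sin Z"
      unfolding tYZ by (simp_all add: cos_add cos_diff sin_add sin_diff)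
    have sinZ: "sin Z \<ge> 0"
      using t \<theta>_pos[of i] by (intro sin_ge_zero) (auto simp: Z_def)
    have "2 * \<theta> i \<ge> \<theta> j"
      using assms(1) \<theta>_Suc[of j] \<theta>_pos[of j] by auto
    then have Y: "\<theta> j \<le> Y" "Y \<le> pi"
      using False t \<theta>_le[of i] by (auto simp: Y_def)
    have H: "H \<ge> 2 * apo j"
      using apo_Suc[of j] rad_pos[of j] by (simp add: H_def)
    have "2 * q * cos Y \<le> H * sin Y"
    proof (cases "Y \<le> pi / 2")
      case True
      have "q * cos Y \<le> q * cos (\<theta> j)"
        using Y q_pos \<theta>_pos[of j] by (intro mult_left_mono cos_monotone_0_pi_le) auto
      also have "\<dots> = apo j * sin (\<theta> j)"
        by (simp add: apo_def flip: rad_sin[of j])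
      also have "\<dots> \<le> apo j * sin Y"
        using Y True apo_pos[of j] \<theta>_pos[of j] by (intro mult_left_mono sin_monotone_2pi_le) auto
      finally have "2 * q * cos Y \<le> 2 * apo j * sin Y" by simp
      also have "\<dots> \<le> H * sin Y"
        using H Y \<theta>_pos[of j] by (intro mult_right_mono sin_ge_zero) auto
      finally show ?thesis .
    next
      case False
      then have "cos Y \<le> 0"
        using Y cos_monotone_0_pi_le[of "pi / 2" Y] by simp
      then have "2 * q * cos Y \<le> 0"
        using q_pos by (simp add: mult_nonneg_nonpos)
      moreover have "0 \<le> H * sin Y"
        using H apo_pos[of j] Y \<theta>_pos[of j] by (intro mult_nonneg_nonneg sin_ge_zero) auto
      ultimately show ?thesis by linarith
    qed
    then have "(2 * q * cos Y - H * sin Y) * (2 * sin Z) \<le> 0"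
      using sinZ by (intro mult_nonpos_nonneg) auto
    then show ?thesis unfolding diff by (simp add: algebra_simps)
  qed simp
  then have "rad i * (H * (cos t - cos (\<theta> i)) + 2 * q * (sin t - sin (\<theta> i))) \<le> 0"
    using rad_pos[of i] by (intro mult_nonneg_nonpos) auto
  moreover have "2 * q\<^sup>2 = 2 * q * (rad i * sin (\<theta> i))"
    by (simp add: rad_sin power2_eq_square)
  moreover have "\<bar>rad i * sin g\<bar> = rad i * sin t"
    using t rad_pos[of i] by (simp add: abs_mult)
  ultimately show ?thesis
    using t by (simp add: apo_def algebra_simps)
qed

text \<open>On the two rings of the rectangle the positions of the vertices matter, by
  \<open>side_ineq\<close>. For every other ring the whole circle satisfies the bound, by
  \<open>cos_sin_le\<close> and the cap inequalities.\<close>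

lemma side_ineq_all:
  fixes i j :: nat and l \<kappa> :: int
  defines "g \<equiv> ang i l - 2 * of_int \<kappa> * \<theta> j" and "H \<equiv> apo j + apo (Suc j)"
  shows "(rad i * cos g - apo i) * H + 2 * q * \<bar>rad i * sin g\<bar>
    \<le> 2 * q\<^sup>2 + (apo i - apo j) * (apo i - apo (Suc j))"
proof (cases "i = j \<or> i = Suc j")
  case True
  then show ?thesis
    using side_ineq[OF True, of l \<kappa>] by (auto simp: g_def H_def algebra_simps)
next
  case False
  have H: "H > 0" using apo_pos by (simp add: H_def add_pos_pos)
  have "rad i * (H * cos g + 2 * q * \<bar>sin g\<bar>) \<le> rad i * (H + 2 * q\<^sup>2 / H)"
    using cos_sin_le[OF H, of q g] q_pos rad_pos[of i] by (intro mult_left_mono) auto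
  then have le: "rad i * cos g * H + 2 * q * \<bar>rad i * sin g\<bar> \<le> rad i * H + 2 * q\<^sup>2 * rad i / H"
    using rad_pos[of i] by (simp add: abs_mult algebra_simps)
  show ?thesis
  proof (cases "i < j")
    case True
    have "rad i \<le> H"
      using rad_le_apo[OF True] apo_pos[of i] apo_pos[of "Suc j"] by (simp add: H_def)
    then have "2 * q\<^sup>2 * rad i / H \<le> 2 * q\<^sup>2 * H / H"
      using H by (intro divide_right_mono mult_left_mono) auto
    then have "2 * q\<^sup>2 * rad i / H \<le> 2 * q\<^sup>2"
      using H by simp
    then show ?thesis
      using le cap_ineq_above[OF True] by (simp add: H_def algebra_simps)
  next
    case False
    then have "Suc j < i" using \<open>\<not> (i = j \<or> i = Suc j)\<close> by auto
    then show ?thesis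
      using le cap_ineq_below[of j i] by (simp add: H_def algebra_simps)
  qed
qed

lemma diag_ineq_all:
  fixes i j :: nat and l \<kappa> :: int
  defines "g \<equiv> ang i l - 2 * of_int \<kappa> * \<theta> j"
  shows "(rad i * cos g - apo i) * (apo j + apo (Suc j)) \<le> (apo i - apo j) * (apo i - apo (Suc j))"
proof (cases "i < j")
  case True
  have "(rad i * cos g - apo i) * (apo j + apo (Suc j)) \<le> (rad i - apo i) * (apo j + apo (Suc j))"
    using rad_cos_le[of i g] apo_pos[of j] apo_pos[of "Suc j"] by (intro mult_right_mono) auto
  then show ?thesis
    using cap_ineq_above[OF True] by (simp add: algebra_simps)
next
  case False
  then have "(rad i * cos g - apo i) * (apo j + apo (Suc j)) \<le> 0"
    using rad_cos_centre_le[of j i l \<kappa>] apo_pos[of j] apo_pos[of "Suc j"]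
    by (intro mult_nonpos_nonneg) (auto simp: g_def)
  moreover have "0 \<le> (apo i - apo j) * (apo i - apo (Suc j))"
  proof (cases "i = j")
    case False
    then show ?thesis
      using \<open>\<not> i < j\<close> apo_mono[of j i] apo_mono[of "Suc j" i] by (intro mult_nonneg_nonneg) auto
  qed simp
  ultimately show ?thesis by linarith
qed

text \<open>The two points are seen from the axis at the angles \<open>- \<epsilon> \<theta>\<^sub>j\<close> and
  \<open>\<delta> \<theta>\<^sub>j\<^sub>+\<^sub>1\<close>, measured from the symmetry plane of a rectangle:
  they span a diagonal if \<open>\<delta> = \<epsilon>\<close> and a side otherwise.\<close>
lemma gabriel_rectangle:
  fixes \<kappa> :: int and \<epsilon> \<delta> :: real
  assumes "Suc j \<le> s" "\<sigma> \<in> {1, -1}" "\<epsilon> \<in> {1, -1}" "\<delta> \<in> {1, -1}"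
    and a: "ang j k = 2 * \<kappa> * \<theta> j - \<epsilon> * \<theta> j"
    and b: "ang (Suc j) k' = 2 * \<kappa> * \<theta> j + \<delta> * \<theta> (Suc j)"
  shows "gabriel points (pt j k \<sigma>) (pt (Suc j) k' \<sigma>)"
  unfolding gabriel_def
proof
  fix x assume "x \<in> points"
  then obtain i l \<tau> where x: "x = pt i l \<tau>" "i \<le> s" "\<tau> \<in> {1, -1}"
    by (auto simp: points_def)
  have j: "j \<le> s" using assms by simp
  \<comment> \<open>In a horizontal frame whose first axis lies in the symmetry plane,
    \<open>x\<close> has coordinates \<open>X\<close>, \<open>Y\<close>, and the two endpoints have
    \<open>(d, - \<epsilon> * q)\<close> and \<open>(d', \<delta> * q)\<close>.\<close>
  define g where "g = ang i l - 2 * of_int \<kappa> * \<theta> j"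
  define X where "X = rad i * cos g"
  define Y where "Y = rad i * sin g"
  define d where "d = apo j"
  define d' where "d' = apo (Suc j)"
  define z where "z = ht j"
  define z' where "z' = ht (Suc j)"
  have zpos: "z > 0" "z' > 0"
    using assms ht_pos j by (auto simp: z_def z'_def)
  have g: "ang i l - ang j k = g + \<epsilon> * \<theta> j" "ang i l - ang (Suc j) k' = g - \<delta> * \<theta> (Suc j)"
    by (simp_all add: g_def a b)
  have "rad i * rad j * cos (g + \<epsilon> * \<theta> j) = X * d - \<epsilon> * Y * q"
    using assms(3) by (auto simp: X_def Y_def d_def apo_def cos_add cos_diff algebra_simps
        simp flip: rad_sin[of j])
  moreover have "rad i * rad (Suc j) * cos (g - \<delta> * \<theta> (Suc j)) = X * d' + \<delta> * Y * q"
    using assms(4) by (auto simp: X_def Y_def d'_def apo_def cos_add cos_diff algebra_simps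
        simp flip: rad_sin[of "Suc j"])
  ultimately have "x \<bullet> (pt j k \<sigma> + pt (Suc j) k' \<sigma>)
      = X * (d + d') + (\<delta> - \<epsilon>) * q * Y + \<tau> * \<sigma> * ht i * (z + z')"
    unfolding x inner_add_right pt_inner g by (simp add: z_def z'_def algebra_simps)
  also have "\<dots> \<le> X * (d + d') + (\<delta> - \<epsilon>) * q * Y + ht i * (z + z')"
    using sign_ht_le[of \<sigma> \<tau> i "z + z'"] assms x zpos by simp
  also have "\<dots> \<le> 1 + d * d' - \<epsilon> * \<delta> * q\<^sup>2 + z * z'"
  proof -
    \<comment> \<open>Writing 1 as the sum of the squares of \<open>apo i\<close>,
      \<open>ht i\<close> and \<open>q\<close> splits the claim into this horizontal inequality and
      \<open>0 \<le> (ht i - z) * (ht i - z')\<close>. The latter holds since no ring lies strictly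
      between two consecutive ones.\<close>
    have "(X - apo i) * (d + d') + (\<delta> - \<epsilon>) * q * Y
        \<le> (1 - \<epsilon> * \<delta>) * q\<^sup>2 + (apo i - d) * (apo i - d')"
    proof (cases "\<delta> = \<epsilon>")
      case True
      then show ?thesis
        using diag_ineq_all[of i l \<kappa> j] assms(3) by (auto simp: X_def g_def d_def d'_def)
    next
      case False
      then have \<delta>: "\<delta> = - \<epsilon>" using assms by auto
      have "(\<delta> - \<epsilon>) * q * Y \<le> 2 * q * \<bar>Y\<bar>"
        using assms(3) q_pos unfolding \<delta> by (auto simp: abs_if)
      moreover have "(1 - \<epsilon> * \<delta>) = 2"
        using assms(3) unfolding \<delta> by auto
      ultimately show ?thesis
        using side_ineq_all[of i l \<kappa> j] by (simp add: X_def Y_def g_def d_def d'_def)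
    qed
    moreover have "0 \<le> (ht i - z) * (ht i - z')"
    proof (cases "i \<le> j")
      case True
      then show ?thesis
        using ht_antimono[of i j] ht_antimono[of i "Suc j"]
        by (intro mult_nonneg_nonneg) (auto simp: z_def z'_def)
    next
      case False
      then show ?thesis
        using ht_antimono[of j i] ht_antimono[of "Suc j" i]
        by (intro mult_nonpos_nonpos) (auto simp: z_def z'_def)
    qed
    ultimately show ?thesis
      using apo_ht_sq[OF x(2)] by (simp add: algebra_simps power2_eq_square)
  qed
  also have "1 + d * d' - \<epsilon> * \<delta> * q\<^sup>2 + z * z' = 1 + pt j k \<sigma> \<bullet> pt (Suc j) k' \<sigma>"
  proof -
    have "ang j k - ang (Suc j) k' = - (\<epsilon> * \<theta> j + \<delta> * \<theta> (Suc j))"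
      by (simp add: a b)
    then have "cos (ang j k - ang (Suc j) k') = cos (\<epsilon> * \<theta> j + \<delta> * \<theta> (Suc j))"
      by (metis cos_minus)
    moreover have "cos (\<epsilon> * \<theta> j + \<delta> * \<theta> (Suc j))
        = cos (\<theta> j) * cos (\<theta> (Suc j)) - \<epsilon> * \<delta> * (sin (\<theta> j) * sin (\<theta> (Suc j)))"
      using assms(3,4) by (auto simp: cos_add cos_diff)
    moreover have "\<sigma> * \<sigma> = 1" using assms(2) by auto
    moreover have "q\<^sup>2 = rad j * rad (Suc j) * (sin (\<theta> j) * sin (\<theta> (Suc j)))"
      by (simp add: power2_eq_square flip: rad_sin[of j]) (simp add: rad_sin[of j] flip: rad_sin[of "Suc j"])
    ultimately have "rad j * rad (Suc j) * cos (ang j k - ang (Suc j) k')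
        = d * d' - \<epsilon> * \<delta> * q\<^sup>2"
      by (simp only: d_def d'_def apo_def) (simp add: algebra_simps)
    then show ?thesis
      using \<open>\<sigma> * \<sigma> = 1\<close> by (simp add: pt_inner z_def z'_def)
  qed
  finally show "x \<bullet> (pt j k \<sigma> + pt (Suc j) k' \<sigma>) \<le> 1 + pt j k \<sigma> \<bullet> pt (Suc j) k' \<sigma>" .
qed

text \<open>Offsets 0 and 1 give sides of rectangles, -1 and 2 give diagonals. Offsets 1 and 2 use
  the rectangle on the side after vertex \<open>k\<close>, the others the one before it.\<close>

lemma gabriel_child:
  assumes "Suc j \<le> s" "\<sigma> \<in> {1, -1}" "e \<in> {-1, 0, 1, 2}"
  shows "gabriel points (pt j k \<sigma>) (pt (Suc j) (2 * k + e) \<sigma>)"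
proof (cases "e \<in> {1, 2}")
  case True
  then show ?thesis
    using assms by (intro gabriel_rectangle[of j \<sigma> 1 "2 * of_int e - 3" k "k + 1"])
      (auto simp: ang_def \<theta>_Suc[of j] algebra_simps)
next
  case False
  then show ?thesis
    using assms by (intro gabriel_rectangle[of j \<sigma> "-1" "2 * of_int e + 1" k k])
      (auto simp: ang_def \<theta>_Suc[of j] algebra_simps)
qed

section \<open>Edges across the equator and the diagonals of the top squares\<close>

lemma gabriel_equator_straight:
  assumes "\<sigma> \<in> {1, -1}"
  shows "gabriel points (pt s k \<sigma>) (pt s k (- \<sigma>))"
  unfolding gabriel_def
proof
  fix x assume "x \<in> points"
  then obtain i l \<tau> where x: "x = pt i l \<tau>" "i \<le> s"
    by (auto simp: points_def)
  have "x \<bullet> (pt s k \<sigma> + pt s k (- \<sigma>)) = 2 * (rad i * cos (ang i l - ang s k)) * rad s"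
    unfolding x inner_add_right pt_inner by (simp add: algebra_simps)
  also have "\<dots> \<le> 2 * rad s * rad s"
    using rad_cos_le[of i "ang i l - ang s k"] rad_mono[OF x(2)] rad_pos[of s]
    by (intro mult_right_mono) auto
  also have "\<dots> = 1 + pt s k \<sigma> \<bullet> pt s k (- \<sigma>)"
    using assms ht_sq[of s] by (auto simp: pt_inner power2_eq_square)
  finally show "x \<bullet> (pt s k \<sigma> + pt s k (- \<sigma>)) \<le> 1 + pt s k \<sigma> \<bullet> pt s k (- \<sigma>)" .
qed

lemma gabriel_equator_diag:
  assumes "\<sigma> \<in> {1, -1}"
  shows "gabriel points (pt s k \<sigma>) (pt s (k + 1) (- \<sigma>))"
  unfolding gabriel_def
proof
  fix x assume "x \<in> points"
  then obtain i l \<tau> where x: "x = pt i l \<tau>" "i \<le> s"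
    by (auto simp: points_def)
  define g where "g = ang i l - 2 * of_int (k + 1) * \<theta> s"
  have g: "ang i l - ang s k = g + \<theta> s" "ang i l - ang s (k + 1) = g - \<theta> s"
    by (simp_all add: g_def ang_def algebra_simps)
  have "rad i * cos g \<le> apo s"
  proof (cases "i = s")
    case True
    then show ?thesis using rad_cos_centre_le[of s s l "k + 1"] by (simp add: g_def)
  next
    case False
    then show ?thesis
      using rad_cos_le[of i g] rad_le_apo[of i s] apo_pos[of i] x by simp
  qed
  then have "2 * (rad i * cos g) * apo s \<le> 2 * apo s * apo s"
    using apo_pos[of s] by (intro mult_right_mono) auto
  moreover have "x \<bullet> (pt s k \<sigma> + pt s (k + 1) (- \<sigma>)) = 2 * (rad i * cos g) * apo s"
    unfolding x inner_add_right pt_inner g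
    by (simp add: cos_add cos_diff apo_def algebra_simps)
  moreover have "1 + pt s k \<sigma> \<bullet> pt s (k + 1) (- \<sigma>) = 2 * apo s * apo s"
    using assms ht_sq[of s] rad_sq[of s] rad_sq_cos[of s]
    by (auto simp: pt_inner ang_Suc power2_eq_square)
  ultimately show "x \<bullet> (pt s k \<sigma> + pt s (k + 1) (- \<sigma>)) \<le> 1 + pt s k \<sigma> \<bullet> pt s (k + 1) (- \<sigma>)"
    by simp
qed

text \<open>Opposite vertices of a square have a vertical sum, so only the height of
  \<open>x\<close> matters, and that is greatest on ring 0.\<close>

lemma gabriel_top:
  assumes "h = 2" "\<sigma> \<in> {1, -1}"
  shows "gabriel points (pt 0 k \<sigma>) (pt 0 (k + 2) \<sigma>)"
  unfolding gabriel_def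
proof
  fix x assume "x \<in> points"
  then obtain i l \<tau> where x: "x = pt i l \<tau>" "i \<le> s" "\<tau> \<in> {1, -1}"
    by (auto simp: points_def)
  have "\<theta> 0 = pi / 4"
    unfolding \<theta>_def ring_size_def using assms(1) by simp
  then have ang: "ang 0 (k + 2) = ang 0 k + pi"
    by (simp add: ang_def algebra_simps)
  have "x \<bullet> (pt 0 k \<sigma> + pt 0 (k + 2) \<sigma>) = \<tau> * \<sigma> * ht i * (2 * ht 0)"
    unfolding x inner_add_right pt_inner ang diff_diff_eq[symmetric] cos_minus_pi
    by (simp add: algebra_simps)
  also have "\<dots> \<le> ht i * (2 * ht 0)"
    using sign_ht_le[of \<sigma> \<tau> i "2 * ht 0"] assms x ht_pos[of 0] by simp
  also have "\<dots> \<le> ht 0 * (2 * ht 0)"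
    using ht_antimono[of 0 i] ht_pos[of 0] by (intro mult_right_mono) auto
  also have "\<dots> = 1 + pt 0 k \<sigma> \<bullet> pt 0 (k + 2) \<sigma>"
    using assms(2) ht_sq[of 0] unfolding pt_inner ang by (auto simp: power2_eq_square)
  finally show "x \<bullet> (pt 0 k \<sigma> + pt 0 (k + 2) \<sigma>) \<le> 1 + pt 0 k \<sigma> \<bullet> pt 0 (k + 2) \<sigma>" .
qed


subsection \<open>Pairs that are not Gabriel edges\<close>

lemma gabrielD: "gabriel points a b \<Longrightarrow> x \<in> points \<Longrightarrow> x \<bullet> a + x \<bullet> b \<le> 1 + a \<bullet> b"
  by (simp add: gabriel_def inner_add_right)

text \<open>The blocking points are the two neighbours of the first point on its own ring; the one
  on the side of the second point gives the bound.\<close>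

lemma gabriel_sin_le:
  assumes "gabriel points (pt i k \<sigma>) (pt j l \<tau>)" "i \<le> s" "\<sigma> \<in> {1, -1}"
  defines "D \<equiv> ang j l - ang i k"
  shows "sin (\<bar>D\<bar> - \<theta> i) \<le> sin (\<theta> j)"
proof -
  have bound: "sin (\<epsilon> * D - \<theta> i) \<le> sin (\<theta> j)" if \<epsilon>: "\<epsilon> \<in> {1, -1}" for \<epsilon> :: real
  proof -
    define k' where "k' = (if \<epsilon> = 1 then k + 1 else k - 1)"
    have ang: "ang i k' = ang i k + 2 * \<epsilon> * \<theta> i"
      using \<epsilon> by (auto simp: k'_def ang_def algebra_simps)
    define u where "u = \<epsilon> * D - \<theta> i"
    have c1: "cos (ang i k' - ang i k) = cos (2 * \<theta> i)"
      using \<epsilon> by (auto simp: ang)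
    have c2: "cos (ang i k' - ang j l) = cos (u - \<theta> i)"
      using \<epsilon> cos_minus[of "D - 2 * \<theta> i"] by (auto simp: ang u_def D_def algebra_simps)
    have c3: "cos (ang i k - ang j l) = cos (u + \<theta> i)"
      using \<epsilon> cos_minus[of D] by (auto simp: u_def D_def)
    have "pt i k' \<sigma> \<bullet> pt i k \<sigma> + pt i k' \<sigma> \<bullet> pt j l \<tau> \<le> 1 + pt i k \<sigma> \<bullet> pt j l \<tau>"
      using assms pt_in_points by (intro gabrielD) auto
    then have "rad i * rad i * cos (2 * \<theta> i) + \<sigma> * \<sigma> * ht i * ht i + rad i * rad j * cos (u - \<theta> i)
        \<le> 1 + rad i * rad j * cos (u + \<theta> i)"
      unfolding pt_inner c1 c2 c3 by simp
    moreover have "\<sigma> * \<sigma> * ht i * ht i = 1 - (rad i)\<^sup>2"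
      using assms ht_sq[of i] by (auto simp: power2_eq_square)
    ultimately have "rad i * rad j * (cos (u - \<theta> i) - cos (u + \<theta> i)) \<le> 2 * q\<^sup>2"
      using rad_sq_cos[of i] by (simp add: algebra_simps)
    moreover have "rad i * rad j * (cos (u - \<theta> i) - cos (u + \<theta> i)) = 2 * (rad i * sin (\<theta> i)) * rad j * sin u"
      by (simp add: cos_diff cos_add algebra_simps)
    ultimately have "q * (rad j * sin u) \<le> q * q"
      by (simp add: rad_sin power2_eq_square)
    then have "rad j * sin u \<le> rad j * sin (\<theta> j)"
      using q_pos by (simp add: rad_sin)
    then show ?thesis
      using rad_pos[of j] by (simp add: u_def)
  qed
  show ?thesis
    using bound[of 1] bound[of "-1"] by (cases "D \<ge> 0") auto
qed

text \<open>If the first alternative fails, \<open>gabriel_sin_le\<close> forces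
  \<open>\<bar>D\<bar> \<ge> pi + \<theta> i - \<theta> j\<close>, which is at least
  \<open>pi\<close>, with equality only on a common ring.\<close>

lemma gabriel_angle_cases:
  assumes "gabriel points (pt i k \<sigma>) (pt j l \<tau>)" "i \<le> s" "\<sigma> \<in> {1, -1}" "i \<le> j"
  defines "D \<equiv> ang j l - ang i k"
  assumes D: "\<bar>D\<bar> \<le> pi"
  shows "\<bar>D\<bar> \<le> \<theta> i + \<theta> j \<or> \<bar>D\<bar> = pi \<and> i = j"
proof (cases "\<bar>D\<bar> \<le> \<theta> i + \<theta> j")
  case False
  have "sin (\<bar>D\<bar> - \<theta> i) \<le> sin (\<theta> j)"
    using gabriel_sin_le[OF assms(1-3)] by (simp add: D_def)
  then have "pi - \<theta> j \<le> \<bar>D\<bar> - \<theta> i"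
    using False \<theta>_pos[of j] \<theta>_le[of j] by (intro sin_le_sin_cases) auto
  then show ?thesis
    using D \<theta>_strict[of i j] assms(4) by (cases "i = j") auto
qed simp

text \<open>The blocking point is the neighbour of the first point in ring \<open>i + 1\<close> that spans
  a side of a rectangle with it, on the side on which the second point lies.\<close>
lemma gabriel_next_ring:
  assumes "gabriel points (pt i k \<sigma>) (pt j l \<tau>)" "Suc i \<le> s" "\<sigma> \<in> {1, -1}"
  defines "D \<equiv> ang j l - ang i k"
  shows "rad i * (rad j * cos (\<bar>D\<bar> - \<theta> i) - apo (Suc i))
    \<le> - ((ht i - ht (Suc i)) * (ht (Suc i) - \<sigma> * \<tau> * ht j))"
proof -
  define \<epsilon> :: real where "\<epsilon> = (if D \<ge> 0 then 1 else -1)"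
  define k' where "k' = (if D \<ge> 0 then 2 * k + 1 else 2 * k)"
  define \<psi> where "\<psi> = \<bar>D\<bar> - \<theta> i"
  define t where "t = \<theta> (Suc i)"
  have \<theta>i: "\<theta> i = 2 * t" using \<theta>_Suc[of i] by (simp add: t_def)
  have ang: "ang (Suc i) k' = ang i k + \<epsilon> * t"
    by (auto simp: k'_def \<epsilon>_def ang_def \<theta>i t_def[symmetric] algebra_simps)
  have D: "D = \<epsilon> * (\<psi> + 2 * t)"
    by (auto simp: \<epsilon>_def \<psi>_def \<theta>i)
  have c1: "cos (ang (Suc i) k' - ang i k) = cos (2 * t - t)"
    by (auto simp: ang \<epsilon>_def)
  have c2: "cos (ang (Suc i) k' - ang j l) = cos (\<psi> + t)"
  proof -
    have "ang (Suc i) k' - ang j l = - \<epsilon> * (\<psi> + t)"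
      using D by (simp add: ang D_def algebra_simps)
    then show ?thesis by (simp add: \<epsilon>_def cos_minus[of "\<psi> + t", simplified])
  qed
  have c3: "cos (ang i k - ang j l) = cos (\<psi> + 2 * t)"
  proof -
    have "ang i k - ang j l = - \<epsilon> * (\<psi> + 2 * t)"
      using D by (simp add: D_def)
    then show ?thesis by (simp add: \<epsilon>_def cos_minus[of "\<psi> + 2 * t", simplified])
  qed
  have \<sigma>: "\<sigma> * \<sigma> = 1" using assms by auto
  have i1: "rad (Suc i) * rad i * cos (2 * t - t) = apo (Suc i) * apo i + q\<^sup>2"
  proof -
    have "q\<^sup>2 = (rad i * sin (\<theta> i)) * (rad (Suc i) * sin t)"
      by (simp add: rad_sin power2_eq_square t_def)
    then show ?thesis
      unfolding cos_diff \<theta>i[symmetric] apo_def t_def[symmetric] by (simp add: algebra_simps)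
  qed
  have i2: "rad (Suc i) * rad j * cos (\<psi> + t) = rad j * (cos \<psi> * apo (Suc i) - q * sin \<psi>)"
    unfolding cos_add apo_def t_def by (simp add: algebra_simps flip: rad_sin[of "Suc i"])
  have i3: "rad i * rad j * cos (\<psi> + 2 * t) = rad j * (cos \<psi> * apo i - q * sin \<psi>)"
    unfolding cos_add apo_def \<theta>i[symmetric] by (simp add: algebra_simps flip: rad_sin[of i])
  have "pt (Suc i) k' \<sigma> \<bullet> pt i k \<sigma> + pt (Suc i) k' \<sigma> \<bullet> pt j l \<tau> \<le> 1 + pt i k \<sigma> \<bullet> pt j l \<tau>"
    using assms pt_in_points by (intro gabrielD) auto
  then have "apo (Suc i) * apo i + q\<^sup>2 + ht (Suc i) * ht i
      + rad j * (cos \<psi> * apo (Suc i) - q * sin \<psi>) + \<sigma> * \<tau> * ht (Suc i) * ht j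
      \<le> 1 + rad j * (cos \<psi> * apo i - q * sin \<psi>) + \<sigma> * \<tau> * ht i * ht j"
    unfolding pt_inner c1 c2 c3 i1 i2 i3 \<sigma> by simp
  moreover have "1 = (apo (Suc i))\<^sup>2 + (ht (Suc i))\<^sup>2 + q\<^sup>2"
    using apo_ht_sq[OF assms(2)] by simp
  ultimately have "rad j * cos \<psi> * (apo (Suc i) - apo i) - apo (Suc i) * (apo (Suc i) - apo i)
    \<le> - ((ht i - ht (Suc i)) * (ht (Suc i) - \<sigma> * \<tau> * ht j))"
    by (simp add: algebra_simps power2_eq_square)
  then show ?thesis
    by (simp add: apo_Suc[of i] \<psi>_def algebra_simps)
qed

lemma ang_diff:
  assumes "i \<le> j"
  shows "ang j l - ang i k = (2 * real_of_int (l - 2 ^ (j - i) * k) + 1 - 2 ^ (j - i)) * \<theta> j"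
proof -
  have "\<theta> i = 2 ^ (j - i) * \<theta> j"
    using \<theta>_add[of i "j - i"] assms by simp
  then show ?thesis by (simp add: ang_def algebra_simps)
qed

text \<open>This makes the left side of \<open>gabriel_next_ring\<close> nonnegative for
  \<open>i < j\<close>, so that the heights must produce the contradiction or the equality
  \<open>j = Suc i\<close>.\<close>

lemma rad_cos_ge_apo:
  assumes "i < j" "\<bar>D\<bar> \<le> \<theta> i + \<theta> j" "D = ang j l - ang i k"
  shows "apo (Suc i) \<le> rad j * cos (\<bar>D\<bar> - \<theta> i)"
proof (cases "j = Suc i")
  case True
  define p where "p = 2 * (l - 2 * k) - 1"
  have D: "D = p * \<theta> j"
    using ang_diff[of i j l k] assms True by (simp add: p_def)
  \<comment> \<open>As \<open>p\<close> is odd, \<open>\<bar>D\<bar>\<close> lies between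
    \<open>\<theta> j\<close> and \<open>3 * \<theta> j\<close>, that is within
    \<open>\<theta> j\<close> of \<open>\<theta> i = 2 * \<theta> j\<close>.\<close>
  have "p \<noteq> 0" unfolding p_def by presburger
  then have "1 * \<theta> j \<le> \<bar>real_of_int p\<bar> * \<theta> j"
    using \<theta>_pos[of j] by (intro mult_right_mono) auto
  then have "\<theta> j \<le> \<bar>D\<bar>"
    using \<theta>_pos[of j] by (simp add: D abs_mult)
  then have "\<bar>\<bar>D\<bar> - \<theta> i\<bar> \<le> \<theta> j"
    using assms \<theta>_Suc[of i] True by auto
  then have "cos (\<theta> j) \<le> cos \<bar>\<bar>D\<bar> - \<theta> i\<bar>"
    using \<theta>_le[of j] pi_gt_zero by (intro cos_monotone_0_pi_le) auto
  then have "rad j * cos (\<theta> j) \<le> rad j * cos (\<bar>D\<bar> - \<theta> i)"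
    using rad_pos[of j] by simp
  then show ?thesis by (simp add: True apo_def)
next
  case False
  then have j: "Suc i < j" using assms by simp
  have "\<bar>\<bar>D\<bar> - \<theta> i\<bar> \<le> pi / 3"
    using assms(1,2) \<theta>_antimono[of i j] \<theta>_le[of i] pi_gt_zero by linarith
  then have "cos (pi / 3) \<le> cos \<bar>\<bar>D\<bar> - \<theta> i\<bar>"
    by (intro cos_monotone_0_pi_le) auto
  then have "1 / 2 \<le> cos (\<bar>D\<bar> - \<theta> i)"
    by (simp add: cos_60)
  then have "rad j * (1 / 2) \<le> rad j * cos (\<bar>D\<bar> - \<theta> i)"
    using rad_pos[of j] by (intro mult_left_mono) auto
  moreover have "2 * apo (Suc i) \<le> rad j"
    using rad_le_apo[OF j] apo_less_rad[of "Suc i"] apo_less_rad[of j] by simp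
  ultimately show ?thesis by simp
qed

lemma pt_antipodal:
  assumes "\<bar>ang i l - ang i k\<bar> = pi"
  shows "pt i l (- \<sigma>) = - pt i k \<sigma>"
proof -
  have "ang i l = ang i k + pi \<or> ang i l = ang i k - pi"
    using assms by linarith
  then have "cos (ang i l) = - cos (ang i k)" "sin (ang i l) = - sin (ang i k)"
    by auto
  then show ?thesis
    by (simp add: pt_def vec_eq_iff forall_3)
qed

text \<open>Opposite points of a ring in the same hemisphere are blocked by the ring above, if there
  is one. Close pairs in different hemispheres, or more than one ring apart, are blocked by ring
  \<open>Suc i\<close> unless \<open>i = s\<close>.\<close>

lemma gabriel_cases:
  assumes g: "gabriel points (pt i k \<sigma>) (pt j l \<tau>)" and "i \<le> j" "j \<le> s" "\<sigma> \<in> {1, -1}" "\<tau> \<in> {1, -1}"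
  defines "D \<equiv> ang j l - ang i k"
  assumes D: "\<bar>D\<bar> \<le> pi" and ne: "pt j l \<tau> \<noteq> - pt i k \<sigma>"
  shows "(i = j \<and> \<tau> = \<sigma> \<and> \<bar>D\<bar> \<le> 2 * \<theta> j) \<or> (j = Suc i \<and> \<tau> = \<sigma> \<and> \<bar>D\<bar> \<le> 3 * \<theta> j)
    \<or> (i = s \<and> j = s \<and> \<tau> = - \<sigma> \<and> \<bar>D\<bar> \<le> 2 * \<theta> j) \<or> (i = 0 \<and> j = 0 \<and> \<tau> = \<sigma> \<and> \<bar>D\<bar> = pi)"
proof -
  have i: "i \<le> s" using assms by simp
  consider "\<bar>D\<bar> \<le> \<theta> i + \<theta> j" | "\<bar>D\<bar> = pi" "i = j"
    using gabriel_angle_cases[OF g i] assms by (auto simp: D_def)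
  then show ?thesis
  proof cases
    case 2
    have \<tau>: "\<tau> = \<sigma>"
      using ne pt_antipodal[of i l k \<sigma>] 2 assms(4,5) by (auto simp: D_def)
    have "i = 0"
    proof (cases i)
      case (Suc i')
      have cos: "cos (ang i k - ang i l) = -1"
      proof -
        have "cos (ang i k - ang i l) = cos \<bar>D\<bar>"
          by (simp add: D_def 2 abs_minus_commute flip: cos_abs_real[of "ang i k - ang i l"])
        then show ?thesis using 2 by simp
      qed
      have "ang i l = ang i k + pi \<or> ang i l = ang i k - pi"
        using 2 by (auto simp: D_def abs_if split: if_splits)
      then have opp: "cos (g - ang i l) = - cos (g - ang i k)" for g
        by (auto simp: cos_diff)
      have "pt i' 0 \<sigma> \<bullet> pt i k \<sigma> + pt i' 0 \<sigma> \<bullet> pt i l \<sigma> \<le> 1 + pt i k \<sigma> \<bullet> pt i l \<sigma>"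
        using g i Suc assms(4) 2 pt_in_points unfolding \<tau> by (intro gabrielD) auto
      then have "2 * (ht i' * ht i) \<le> 2 * (ht i * ht i)"
        unfolding pt_inner opp[of "ang i' 0"] cos using assms(4) ht_sq[OF i]
        by (auto simp: power2_eq_square mult.commute)
      then have "ht i' \<le> ht i"
        using ht_pos[OF i] by simp
      then show ?thesis using ht_strict[of i' i] Suc by simp
    qed simp
    then show ?thesis using 2 \<tau> by auto
  next
    case 1
    show ?thesis
    proof (cases "i = s")
      case True
      then show ?thesis using 1 assms by auto
    next
      case False
      then have Si: "Suc i \<le> s" using i by simp
      have blk: "rad i * (rad j * cos (\<bar>D\<bar> - \<theta> i) - apo (Suc i))
          \<le> - ((ht i - ht (Suc i)) * (ht (Suc i) - \<sigma> * \<tau> * ht j))"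
        using gabriel_next_ring[OF g Si assms(4)] by (simp add: D_def)
      have hts: "ht (Suc i) < ht i" "0 < ht (Suc i)" "0 < ht j"
        using ht_strict[of i "Suc i"] ht_pos Si assms by auto
      have pos: "0 \<le> rad i * (rad j * cos (\<bar>D\<bar> - \<theta> i) - apo (Suc i))" if "i < j"
        using rad_cos_ge_apo[OF that 1] rad_pos[of i] by (simp add: D_def)
      have \<tau>: "\<tau> = \<sigma>"
      proof (rule ccontr)
        assume "\<tau> \<noteq> \<sigma>"
        then have \<sigma>\<tau>: "\<sigma> * \<tau> = -1" using assms(4,5) by auto
        show False
        proof (cases "i = j")
          case True
          have "cos (\<theta> i) \<le> cos \<bar>\<bar>D\<bar> - \<theta> i\<bar>"
            using 1 True \<theta>_le[of i] pi_gt_zero by (intro cos_monotone_0_pi_le) auto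
          then have "apo i \<le> rad i * cos (\<bar>D\<bar> - \<theta> i)"
            using rad_pos[of i] by (simp add: apo_def)
          then have "rad i * (- rad i) \<le> rad i * (rad i * cos (\<bar>D\<bar> - \<theta> i) - apo (Suc i))"
            using rad_pos[of i] by (intro mult_left_mono) (auto simp: apo_Suc)
          also have "\<dots> \<le> - ((ht i)\<^sup>2 - (ht (Suc i))\<^sup>2)"
            using blk \<sigma>\<tau> True by (simp add: power2_eq_square algebra_simps)
          also have "\<dots> = - ((apo (Suc i))\<^sup>2 - (apo i)\<^sup>2)"
            using apo_ht_sq[OF i] apo_ht_sq[OF Si] by simp
          also have "\<dots> = rad i * (- rad i) - 2 * (rad i * apo i)"
            by (simp add: apo_Suc power2_eq_square algebra_simps)
          finally show False
            using mult_pos_pos[OF apo_pos[of i] rad_pos[of i]] by simp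
        next
          case False
          have "0 < (ht i - ht (Suc i)) * (ht (Suc i) + ht j)"
            using hts by simp
          then show False
            using pos blk \<sigma>\<tau> False assms(2) by simp
        qed
      qed
      moreover have "j \<le> Suc i"
      proof (rule ccontr)
        assume "\<not> j \<le> Suc i"
        then have "0 < (ht i - ht (Suc i)) * (ht (Suc i) - ht j)"
          using hts ht_strict[of "Suc i" j] by simp
        moreover have "\<sigma> * \<tau> = 1" using assms(4,5) \<tau> by auto
        ultimately show False
          using pos blk \<open>\<not> j \<le> Suc i\<close> by simp
      qed
      ultimately show ?thesis
        using 1 assms(2) \<theta>_Suc[of i] by (cases "j = i") (auto simp: le_Suc_eq)
    qed
  qed
qed

end

subsection \<open>Counting\<close>

text \<open>Ordered pairs, so that edges are carried over by the injection (a, b) -> (a, - b); each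
  double-normal pair occurs twice.\<close>

definition normal_rel :: "(real^3) set \<Rightarrow> ((real^3) \<times> (real^3)) set" where
  "normal_rel V = {(p, q). p \<in> V \<and> q \<in> V \<and> p \<noteq> q \<and> V \<subseteq> closed_strip p q}"

lemma card_doubletons:
  assumes "finite R" "\<And>p q. (p, q) \<in> R \<Longrightarrow> (q, p) \<in> R \<and> p \<noteq> q"
  shows "card R = 2 * card ((\<lambda>(p, q). {p, q}) ` R)"
proof -
  let ?f = "\<lambda>(p, q). {p, q}"
  have fib: "card {r \<in> R. ?f r = e} = 2" if "e \<in> ?f ` R" for e
  proof -
    obtain p q where pq: "(p, q) \<in> R" "e = {p, q}"
      using \<open>e \<in> ?f ` R\<close> by auto
    then have "{r \<in> R. ?f r = e} = {(p, q), (q, p)}"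
      using assms(2) by (auto simp: doubleton_eq_iff)
    then show ?thesis using assms(2)[OF pq(1)] by simp
  qed
  have "card R = (\<Sum>e\<in>?f ` R. card {r \<in> R. ?f r = e})"
    using sum.image_gen[OF assms(1), of "\<lambda>_. 1" ?f] by (simp only: card_eq_sum)
  also have "\<dots> = 2 * card (?f ` R)"
    by (simp add: fib)
  finally show ?thesis .
qed

lemma card_normal_rel:
  assumes "finite V"
  shows "card (normal_rel V) = 2 * num_double_normal_pairs V"
proof -
  have "finite (normal_rel V)"
    by (rule finite_subset[of _ "V \<times> V"]) (use assms in \<open>auto simp: normal_rel_def\<close>)
  moreover have "closed_strip q p = closed_strip p q" for p q
    by (auto simp: closed_strip_def inner_diff_right)
  moreover have "double_normal_pairs V = (\<lambda>(p, q). {p, q}) ` normal_rel V"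
    by (auto simp: double_normal_pairs_def normal_rel_def)
  ultimately show ?thesis
    unfolding num_double_normal_pairs_def
    by (subst card_doubletons) (auto simp: normal_rel_def)
qed

text \<open>Along the normal \<open>- b - a\<close>, the two bounding planes are at the levels
  \<open>- (1 + a \<bullet> b)\<close> and \<open>1 + a \<bullet> b\<close>.\<close>

lemma subset_closed_strip_iff:
  assumes "a \<bullet> a = 1" "b \<bullet> b = 1"
  shows "V \<subseteq> closed_strip a (- b) \<longleftrightarrow> (\<forall>x\<in>V. \<bar>x \<bullet> (a + b)\<bar> \<le> 1 + a \<bullet> b)"
  using assms by (auto simp: closed_strip_def subset_iff inner_diff_right inner_add_right
      inner_commute[of b a] abs_le_iff)

context ring_configuration
begin

section \<open>Equality and antipodes of points in terms of their indices\<close>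

lemma pt_periodic: "pt j (k + m * ring_size j) \<sigma> = pt j k \<sigma>"
proof -
  have "ang j (k + m * ring_size j) = ang j k + 2 * of_int m * (ring_size j * \<theta> j)"
    by (simp add: ang_def algebra_simps)
  then have "ang j (k + m * ring_size j) = ang j k + 2 * pi * of_int m"
    by (simp add: ring_size_\<theta>)
  then show ?thesis
    by (simp add: pt_def cos_add sin_add)
qed

lemma pt_cong: "ring_size j dvd k - l \<Longrightarrow> pt j k \<sigma> = pt j l \<sigma>"
  using pt_periodic[of j l _ \<sigma>] by (auto simp: dvd_def algebra_simps)

lemma pt_eq_iff:
  assumes "i \<le> s" "j \<le> s" "\<sigma> \<in> {1, -1}" "\<tau> \<in> {1, -1}"
  shows "pt i k \<sigma> = pt j l \<tau> \<longleftrightarrow> i = j \<and> \<sigma> = \<tau> \<and> ring_size j dvd k - l"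
proof
  assume eq: "pt i k \<sigma> = pt j l \<tau>"
  then have eqs: "rad i * cos (ang i k) = rad j * cos (ang j l)"
      "rad i * sin (ang i k) = rad j * sin (ang j l)" "\<sigma> * ht i = \<tau> * ht j"
    by (simp_all add: pt_def vec_eq_iff forall_3)
  have "\<sigma> = \<tau> \<and> ht i = ht j"
    using eqs(3) assms ht_pos[of i] ht_pos[of j] by auto
  moreover from this have "i = j"
    using ht_strict[of i j] ht_strict[of j i] by (cases i j rule: linorder_cases) auto
  moreover have "ring_size j dvd k - l"
  proof -
    have "sin (ang j k) = sin (ang j l) \<and> cos (ang j k) = cos (ang j l)"
      using eqs rad_pos[of j] \<open>i = j\<close> by auto
    then obtain m :: int where "ang j k = ang j l + 2 * pi * m"
      by (subst (asm) sin_cos_eq_iff) auto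
    then have "of_int (k - l) * \<theta> j = of_int (m * ring_size j) * \<theta> j"
      using ring_size_\<theta>[of j] by (simp add: ang_def algebra_simps)
    then have "of_int (k - l) = (of_int (m * ring_size j) :: real)"
      using \<theta>_pos[of j] by simp
    then have "k - l = m * ring_size j"
      unfolding of_int_eq_iff .
    then show ?thesis by simp
  qed
  ultimately show "i = j \<and> \<sigma> = \<tau> \<and> ring_size j dvd k - l" by simp
qed (auto intro: pt_cong)

lemma uminus_pt: "- pt j k \<sigma> = pt j (k + int h * 2 ^ j) (- \<sigma>)"
proof -
  have "ang j (k + int h * 2 ^ j) - ang j k = ring_size j * \<theta> j"
    by (simp add: ang_def ring_size_def algebra_simps)
  then show ?thesis
    by (intro pt_antipodal[symmetric]) (simp add: ring_size_\<theta>)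
qed

lemma uminus_points: "x \<in> points \<Longrightarrow> - x \<in> points"
  using pt_in_points by (auto simp: points_def uminus_pt)

text \<open>One scheme for all families: \<open>J\<close> holds the starting rings,
  \<open>\<delta>\<close> is the number of rings descended, \<open>E\<close> the index offsets, and
  \<open>\<eta> = -1\<close> means crossing the equator. The factor \<open>2 ^ \<delta>\<close>
  matches the finer indexing of the lower ring.\<close>

definition edges :: "nat set \<Rightarrow> nat \<Rightarrow> int set \<Rightarrow> real \<Rightarrow> ((real^3) \<times> (real^3)) set" where
  "edges J \<delta> E \<eta> =
    {(pt j k \<sigma>, pt (j + \<delta>) (2 ^ \<delta> * k + e) (\<eta> * \<sigma>)) | j k e \<sigma>. j \<in> J \<and> e \<in> E \<and> \<sigma> \<in> {1, -1}}"

lemma card_edges: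
  assumes "\<And>j. j \<in> J \<Longrightarrow> j + \<delta> \<le> s" "E \<subseteq> {-1..2}" "\<eta> \<in> {1, -1}"
  shows "finite (edges J \<delta> E \<eta>)"
    and "int (card (edges J \<delta> E \<eta>)) = 2 * int (card E) * (\<Sum>j\<in>J. ring_size j)"
proof -
  define I where "I = (SIGMA j:J. {0..<ring_size j} \<times> E \<times> {1, -1 :: real})"
  define f where "f = (\<lambda>(j, k, e, \<sigma>). (pt j k \<sigma>, pt (j + \<delta>) (2 ^ \<delta> * k + e) (\<eta> * \<sigma>)))"
  have J: "finite J"
    by (rule finite_subset[of _ "{..s}"]) (use assms(1) in force)+
  have E: "finite E"
    using assms(2) finite_subset by blast
  have eq: "edges J \<delta> E \<eta> = f ` I"
  proof
    show "edges J \<delta> E \<eta> \<subseteq> f ` I"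
    proof
      fix x assume "x \<in> edges J \<delta> E \<eta>"
      then obtain j k e \<sigma> where x: "x = (pt j k \<sigma>, pt (j + \<delta>) (2 ^ \<delta> * k + e) (\<eta> * \<sigma>))"
          "j \<in> J" "e \<in> E" "\<sigma> \<in> {1, -1}"
        by (auto simp: edges_def)
      define k' where "k' = k mod ring_size j"
      have dvd: "ring_size j dvd k - k'"
        by (simp add: k'_def)
      have "ring_size (j + \<delta>) = 2 ^ \<delta> * ring_size j"
        by (simp add: ring_size_def power_add)
      then have "ring_size (j + \<delta>) dvd (2 ^ \<delta> * k + e) - (2 ^ \<delta> * k' + e)"
        using mult_dvd_mono[OF dvd_refl[of "2 ^ \<delta>"] dvd] by (simp add: algebra_simps)
      then have "x = f (j, k', e, \<sigma>)"
        unfolding x f_def using pt_cong dvd by (simp only: prod.case prod.inject)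
      moreover have "(j, k', e, \<sigma>) \<in> I"
        using x ring_size_pos[of j] by (simp add: I_def k'_def)
      ultimately show "x \<in> f ` I" by blast
    qed
    show "f ` I \<subseteq> edges J \<delta> E \<eta>"
      by (auto simp: f_def I_def edges_def)
  qed
  have "inj_on f I"
  proof (rule inj_onI)
    fix x y assume xy: "x \<in> I" "y \<in> I" "f x = f y"
    obtain j k e \<sigma> where x: "x = (j, k, e, \<sigma>)" by (cases x) auto
    obtain j' k' e' \<sigma>' where y: "y = (j', k', e', \<sigma>')" by (cases y) auto
    have I: "j \<in> J" "0 \<le> k" "k < ring_size j" "e \<in> E" "\<sigma> \<in> {1, -1}"
        "j' \<in> J" "0 \<le> k'" "k' < ring_size j'" "e' \<in> E" "\<sigma>' \<in> {1, -1}"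
      using xy by (auto simp: I_def x y)
    have le: "j \<le> s" "j' \<le> s" "j + \<delta> \<le> s" "j' + \<delta> \<le> s"
      using assms(1)[of j] assms(1)[of j'] I by auto
    have "pt j k \<sigma> = pt j' k' \<sigma>'"
      using xy by (simp add: f_def x y)
    then have *: "j = j'" "\<sigma> = \<sigma>'" "ring_size j' dvd k - k'"
      using pt_eq_iff[of j j' \<sigma> \<sigma>' k k'] I le by auto
    then have "k = k'"
      using I dvd_imp_le_int[of "k - k'" "ring_size j'"] by (cases "k = k'") auto
    have signs: "\<eta> * \<sigma> \<in> {1, -1}" "\<eta> * \<sigma>' \<in> {1, -1}"
      using assms(3) I by auto
    have "pt (j + \<delta>) (2 ^ \<delta> * k + e) (\<eta> * \<sigma>) = pt (j' + \<delta>) (2 ^ \<delta> * k' + e') (\<eta> * \<sigma>')"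
      using xy by (simp add: f_def x y)
    then have "ring_size (j' + \<delta>) dvd (2 ^ \<delta> * k + e) - (2 ^ \<delta> * k' + e')"
      using pt_eq_iff[OF le(3,4) signs] by simp
    then have dvd: "ring_size (j' + \<delta>) dvd e - e'"
      by (simp add: \<open>k = k'\<close>)
    have "e \<in> {-1..2}" "e' \<in> {-1..2}"
      using assms(2) I by auto
    \<comment> \<open>Every ring has at least four vertices, so offsets from this window are
      distinguished modulo the ring size.\<close>
    then have "\<bar>e - e'\<bar> \<le> 3" by auto
    then have "e = e'"
      using dvd dvd_imp_le_int[of "e - e'" "ring_size (j' + \<delta>)"] ring_size_ge[of "j' + \<delta>"]
      by (cases "e = e'") auto
    then show "x = y" using * \<open>k = k'\<close> by (simp add: x y)
  qed
  then have "card (edges J \<delta> E \<eta>) = card I"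
    unfolding eq by (rule card_image)
  moreover have "finite I"
    using J E by (auto simp: I_def)
  moreover have "int (card I) = 2 * int (card E) * (\<Sum>j\<in>J. ring_size j)"
  proof -
    have "card I = (\<Sum>j\<in>J. nat (ring_size j) * (card E * 2))"
      unfolding I_def using J E by (subst card_SigmaI) (auto simp: card_cartesian_product mult_2_right)
    then show ?thesis
      using ring_size_pos by (simp add: sum_distrib_left less_imp_le algebra_simps)
  qed
  ultimately show "finite (edges J \<delta> E \<eta>)"
    and "int (card (edges J \<delta> E \<eta>)) = 2 * int (card E) * (\<Sum>j\<in>J. ring_size j)"
    by (simp_all add: eq)
qed

lemma sum_ring_size: "(\<Sum>j<n. ring_size j) = 2 * int h * (2 ^ n - 1)"
  by (induction n) (simp_all add: ring_size_def algebra_simps)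

lemma sum_ring_size': "(\<Sum>j\<le>s. ring_size j) = 2 * int h * (2 ^ Suc s - 1)"
  using sum_ring_size[of "Suc s"] by (simp only: lessThan_Suc_atMost)

lemma finite_points: "finite points" and card_points: "int (card points) = 4 * int h * (2 ^ Suc s - 1)"
proof -
  have "edges {..s} 0 {0} 1 = (\<lambda>a. (a, a)) ` points"
    by (auto simp: edges_def points_def)
  moreover have "inj_on (\<lambda>a. (a, a)) points"
    by (auto intro: inj_onI)
  ultimately show "finite points" "int (card points) = 4 * int h * (2 ^ Suc s - 1)"
    using card_edges[of "{..s}" 0 "{0}" 1] sum_ring_size'
    by (auto simp: card_image finite_image_iff simp del: power_Suc)
qed

text \<open>This contains the pairs \<open>(a, a)\<close>, which stand for the antipodal double-normal pairs
  \<open>{a, - a}\<close>.\<close>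
definition lateral_edges :: "((real^3) \<times> (real^3)) set" where
  "lateral_edges = edges {..s} 0 {-1, 0, 1} 1 \<union> edges {s} 0 {-1, 0, 1} (-1)
    \<union> (edges {..<s} 1 {-1, 0, 1, 2} 1 \<union> prod.swap ` edges {..<s} 1 {-1, 0, 1, 2} 1)"

lemma in_edges:
  assumes "(a, b) \<in> edges J \<delta> E \<eta>"
  obtains j k e \<sigma> where "a = pt j k \<sigma>" "b = pt (j + \<delta>) (2 ^ \<delta> * k + e) (\<eta> * \<sigma>)"
    "j \<in> J" "e \<in> E" "\<sigma> \<in> {1, -1}"
  using assms by (auto simp: edges_def)

text \<open>By \<open>pt_eq_iff\<close> a point determines its ring and hemisphere. Hence families
  with different \<open>\<delta>\<close> or \<open>\<eta>\<close> are disjoint.\<close>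

lemma edges_level:
  assumes "(pt i k \<sigma>, pt j l \<tau>) \<in> edges J \<delta> E \<eta>" "i \<le> s" "j \<le> s" "\<sigma> \<in> {1, -1}" "\<tau> \<in> {1, -1}"
    "\<And>j. j \<in> J \<Longrightarrow> j + \<delta> \<le> s" "\<eta> \<in> {1, -1}"
  shows "j = i + \<delta>" "\<tau> = \<eta> * \<sigma>"
proof -
  obtain j' k' e \<sigma>' where *: "pt i k \<sigma> = pt j' k' \<sigma>'"
      "pt j l \<tau> = pt (j' + \<delta>) (2 ^ \<delta> * k' + e) (\<eta> * \<sigma>')" "j' \<in> J" "\<sigma>' \<in> {1, -1}"
    using assms(1) by (elim in_edges)
  have "\<eta> * \<sigma>' \<in> {1, -1}" using * assms(7) by auto
  then show "j = i + \<delta>" "\<tau> = \<eta> * \<sigma>"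
    using * assms(2-5) assms(6)[of j'] pt_eq_iff by auto
qed

lemma edges_form:
  assumes "x \<in> edges J \<delta> E \<eta>" "\<And>j. j \<in> J \<Longrightarrow> j + \<delta> \<le> s" "\<eta> \<in> {1, -1}"
  obtains j k l \<sigma> where "x = (pt j k \<sigma>, pt (j + \<delta>) l (\<eta> * \<sigma>))" "j + \<delta> \<le> s" "j \<le> s"
    "\<sigma> \<in> {1, -1}" "\<eta> * \<sigma> \<in> {1, -1}"
proof -
  obtain j k e \<sigma> where x: "x = (pt j k \<sigma>, pt (j + \<delta>) (2 ^ \<delta> * k + e) (\<eta> * \<sigma>))" "j \<in> J" "\<sigma> \<in> {1, -1}"
    using assms(1) unfolding edges_def by blast
  moreover have "\<eta> * \<sigma> \<in> {1, -1}" using x assms(3) by auto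
  moreover have "j + \<delta> \<le> s" "j \<le> s" using assms(2)[OF x(2)] by auto
  ultimately show thesis using that by blast
qed

lemma edges_disjoint:
  assumes "\<And>j. j \<in> J \<Longrightarrow> j + \<delta> \<le> s" "\<eta> \<in> {1, -1}"
    and "\<And>j. j \<in> J' \<Longrightarrow> j + \<delta>' \<le> s" "\<eta>' \<in> {1, -1}"
    and "\<delta> \<noteq> \<delta>' \<or> \<eta> \<noteq> \<eta>'"
  shows "edges J \<delta> E \<eta> \<inter> edges J' \<delta>' E' \<eta>' = {}"
proof (rule ccontr)
  assume "edges J \<delta> E \<eta> \<inter> edges J' \<delta>' E' \<eta>' \<noteq> {}"
  then obtain x where x: "x \<in> edges J \<delta> E \<eta>" "x \<in> edges J' \<delta>' E' \<eta>'" by auto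
  obtain j k l \<sigma> where *: "x = (pt j k \<sigma>, pt (j + \<delta>) l (\<eta> * \<sigma>))" "j + \<delta> \<le> s" "j \<le> s"
    "\<sigma> \<in> {1, -1}" "\<eta> * \<sigma> \<in> {1, -1}"
    using edges_form[OF x(1) assms(1,2)] .
  have "j + \<delta> = j + \<delta>'" "\<eta> * \<sigma> = \<eta>' * \<sigma>"
    using edges_level[OF x(2)[unfolded *(1)] *(3,2,4,5) assms(3,4)] by simp_all
  then show False using assms(5) *(4) by auto
qed

lemma edges_swap_disjoint:
  assumes "\<And>j. j \<in> J \<Longrightarrow> j + \<delta> \<le> s" "\<eta> \<in> {1, -1}"
    and "\<And>j. j \<in> J' \<Longrightarrow> j + Suc \<delta>' \<le> s" "\<eta>' \<in> {1, -1}"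
  shows "edges J \<delta> E \<eta> \<inter> prod.swap ` edges J' (Suc \<delta>') E' \<eta>' = {}"
proof (rule ccontr)
  assume "edges J \<delta> E \<eta> \<inter> prod.swap ` edges J' (Suc \<delta>') E' \<eta>' \<noteq> {}"
  then obtain x where x: "x \<in> edges J \<delta> E \<eta>" "prod.swap x \<in> edges J' (Suc \<delta>') E' \<eta>'" by auto
  obtain j k l \<sigma> where *: "x = (pt j k \<sigma>, pt (j + \<delta>) l (\<eta> * \<sigma>))" "j + \<delta> \<le> s" "j \<le> s"
    "\<sigma> \<in> {1, -1}" "\<eta> * \<sigma> \<in> {1, -1}"
    using edges_form[OF x(1) assms(1,2)] .
  have "j = j + \<delta> + Suc \<delta>'"
    using edges_level(1)[OF x(2)[unfolded *(1) swap_simp] *(2,3,5,4) assms(3,4)] by simp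
  then show False by simp
qed

text \<open>Offsets \<open>{-1, 0, 1}\<close> within a ring already contain both orientations; edges
  between rings contain one and are counted twice. In units of \<open>2 * h\<close> the families
  contribute \<open>12 * 2 ^ s - 6\<close>, \<open>6 * 2 ^ s\<close> and
  \<open>16 * 2 ^ s - 16\<close>.\<close>

lemma card_lateral_edges:
  "finite lateral_edges" "int (card lateral_edges) = 2 * int h * (34 * 2 ^ s - 22)"
proof -
  let ?S = "edges {..s} 0 {-1, 0, 1} 1" and ?Q = "edges {s} 0 {-1, 0, 1} (-1)"
  let ?C = "edges {..<s} 1 {-1, 0, 1, 2} 1"
  have S: "finite ?S" "int (card ?S) = 6 * (2 * int h * (2 ^ Suc s - 1))"
    using card_edges[of "{..s}" 0 "{-1, 0, 1}" 1] unfolding sum_ring_size' by auto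
  have Q: "finite ?Q" "int (card ?Q) = 6 * ring_size s"
    using card_edges[of "{s}" 0 "{-1, 0, 1}" "-1"] by auto
  have C: "finite ?C" "int (card ?C) = 8 * (2 * int h * (2 ^ s - 1))"
    using card_edges[of "{..<s}" 1 "{-1, 0, 1, 2}" 1] unfolding sum_ring_size by auto
  have C': "card (prod.swap ` ?C) = card ?C"
    by (rule card_image) (auto intro: inj_onI)
  have CC': "?C \<inter> prod.swap ` ?C = {}"
    using edges_swap_disjoint[of "{..<s}" 1 1 "{..<s}" 0 1] by simp
  have SQ: "?S \<inter> ?Q = {}"
    by (intro edges_disjoint) auto
  have SC: "(?S \<union> ?Q) \<inter> (?C \<union> prod.swap ` ?C) = {}"
  proof -
    have "?S \<inter> ?C = {}" "?Q \<inter> ?C = {}"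
      by (intro edges_disjoint; auto)+
    moreover have "?S \<inter> prod.swap ` ?C = {}" "?Q \<inter> prod.swap ` ?C = {}"
      using edges_swap_disjoint[of "{..s}" 0 1 "{..<s}" 0 1]
        edges_swap_disjoint[of "{s}" 0 "-1" "{..<s}" 0 1] by simp_all
    ultimately show ?thesis by blast
  qed
  show "finite lateral_edges"
    using S Q C by (simp add: lateral_edges_def)
  have "card lateral_edges = card ?S + card ?Q + (card ?C + card ?C)"
    unfolding lateral_edges_def using S Q C C' SQ CC' SC by (simp add: card_Un_disjoint)
  then show "int (card lateral_edges) = 2 * int h * (34 * 2 ^ s - 22)"
    using S Q C by (simp add: ring_size_def algebra_simps)
qed

end

subsection \<open>Arbitrary numbers of points\<close>

text \<open>\<open>M\<close> is the largest power of two with square at most \<open>n\<close>,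
  \<open>h\<close> is the quotient of \<open>n\<close> by \<open>4 * (M - 1)\<close>, and
  \<open>r\<close> is the remainder. The threshold 64 ensures \<open>M \<ge> 8\<close>, from which
  \<open>h \<ge> 2\<close> follows.\<close>

lemma nat_decompose_by_power_of_two:
  fixes n :: nat
  assumes "n \<ge> 64"
  obtains s h r M :: nat where "M = 2 ^ Suc s" "2 \<le> h" "n = 4 * h * (M - 1) + r" "r < 4 * (M - 1)"
    "real M \<le> sqrt n" "real h \<le> sqrt n"
proof -
  define K where "K = Max {k. (2 ^ k)\<^sup>2 \<le> n}"
  have fin: "finite {k. (2 ^ k)\<^sup>2 \<le> n}"
  proof (rule finite_subset)
    show "{k. (2 ^ k)\<^sup>2 \<le> n} \<subseteq> {..n}"
    proof
      fix k assume "k \<in> {k. (2 ^ k)\<^sup>2 \<le> n}"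
      moreover have "k < 2 ^ k" "(2::nat) ^ k \<le> (2 ^ k)\<^sup>2"
        by (simp_all add: power2_eq_square)
      ultimately show "k \<in> {..n}"
        unfolding mem_Collect_eq atMost_iff by linarith
    qed
  qed simp
  have "3 \<in> {k. (2 ^ k)\<^sup>2 \<le> n}" using assms by simp
  then have K: "(2 ^ K)\<^sup>2 \<le> n" "3 \<le> K"
    unfolding K_def using Max_in[OF fin] Max_ge[OF fin] by blast+
  have "Suc K \<notin> {k. (2 ^ k)\<^sup>2 \<le> n}"
    using Max_ge[OF fin, of "Suc K"] by (auto simp: K_def)
  then have K': "n < (2 * 2 ^ K)\<^sup>2" by simp
  define M :: nat where "M = 2 ^ K"
  define h where "h = n div (4 * (M - 1))"
  define r where "r = n mod (4 * (M - 1))"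
  have M: "8 \<le> M"
    using power_increasing[OF K(2), of "2::nat"] by (simp add: M_def)
  have nr: "n = 4 * h * (M - 1) + r"
  proof -
    have "4 * (M - 1) * h + r = n"
      unfolding h_def r_def by (rule mult_div_mod_eq)
    from this[symmetric] show ?thesis by (simp only: ac_simps)
  qed
  have "M * M \<le> n" using K by (simp add: M_def power2_eq_square)
  moreover have "8 * M \<le> M * M" using M by simp
  ultimately have "2 * (4 * (M - 1)) \<le> n" by linarith
  then have "2 \<le> h"
    unfolding h_def using M by (subst less_eq_div_iff_mult_less_eq) auto
  moreover have "r < 4 * (M - 1)"
    unfolding r_def using M by (intro mod_less_divisor) auto
  moreover have "real M \<le> sqrt n"
    using K by (intro real_le_rsqrt) (simp add: M_def flip: of_nat_power)
  moreover have "real h \<le> sqrt n"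
  proof -
    have "h * (2 * M) \<le> h * (4 * (M - 1))"
      using M by (intro mult_left_mono) auto
    also have "\<dots> \<le> n" using nr by simp
    finally have "real (h * (2 * M)) \<le> real n"
      by (rule of_nat_mono)
    then have "real h * (2 * real M) \<le> sqrt n * sqrt n"
      by simp
    \<comment> \<open>Maximality of \<open>M\<close>; with \<open>h * (2 * M) \<le> n\<close> it
      yields the bound on \<open>h\<close>.\<close>
    moreover have "sqrt n < 2 * real M"
    proof (rule real_less_lsqrt)
      have "real n < real ((2 * 2 ^ K)\<^sup>2)"
        using K' by (simp only: of_nat_less_iff)
      then show "real n < (2 * real M)\<^sup>2" by (simp add: M_def)
    qed simp_all
    then have "sqrt n * sqrt n \<le> sqrt n * (2 * real M)"
      by (intro mult_left_mono) auto
    ultimately have "real h * (2 * real M) \<le> sqrt n * (2 * real M)"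
      by linarith
    then show ?thesis using M by simp
  qed
  moreover have "M = 2 ^ Suc (K - 1)"
    using K by (simp add: M_def)
  ultimately show thesis using that nr by blast
qed

text \<open>The hypothesis says that the north pole satisfies all inequalities strictly. By
  continuity so do the points of a short meridian arc from the pole, and these are infinitely
  many.\<close>

lemma sphere_points_near_pole:
  fixes v :: "'b \<Rightarrow> real^3" and f :: "'b \<Rightarrow> real"
  assumes "finite F" "finite X" "\<And>i. i \<in> F \<Longrightarrow> \<bar>v i $ 3\<bar> < f i"
  obtains R where "R \<subseteq> sphere 0 1" "finite R" "card R = r" "R \<inter> X = {}"
    "\<And>x i. x \<in> R \<Longrightarrow> i \<in> F \<Longrightarrow> \<bar>x \<bullet> v i\<bar> \<le> f i"
proof -
  define g :: "real \<Rightarrow> real^3" where "g t = vector [sin t, 0, cos t]" for t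
  have g_inner: "g t \<bullet> v = sin t * v $ 1 + cos t * v $ 3" for t v
    by (simp add: g_def inner_vec_def sum_3)
  have "\<forall>i\<in>F. \<forall>\<^sub>F t in at_right 0. \<bar>g t \<bullet> v i\<bar> < f i"
  proof
    fix i assume i: "i \<in> F"
    have "((\<lambda>t. \<bar>sin t * v i $ 1 + cos t * v i $ 3\<bar>)
        \<longlongrightarrow> \<bar>sin 0 * v i $ 1 + cos 0 * v i $ 3\<bar>) (at_right 0)"
      by (intro tendsto_intros)
    then show "\<forall>\<^sub>F t in at_right 0. \<bar>g t \<bullet> v i\<bar> < f i"
      unfolding g_inner using assms(3)[OF i] by (intro order_tendstoD) auto
  qed
  then have "\<forall>\<^sub>F t in at_right 0. \<forall>i\<in>F. \<bar>g t \<bullet> v i\<bar> < f i"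
    using assms(1) by (simp add: eventually_ball_finite)
  then obtain b where b: "b > 0" "\<And>t i. 0 < t \<Longrightarrow> t < b \<Longrightarrow> i \<in> F \<Longrightarrow> \<bar>g t \<bullet> v i\<bar> < f i"
    unfolding eventually_at_right_field by blast
  \<comment> \<open>The bound 1 keeps \<open>T\<close> inside [0, pi], where cosine is
    injective.\<close>
  define T where "T = {0<..<min b 1}"
  have "inj_on g T"
  proof (rule inj_onI)
    fix t u assume "t \<in> T" "u \<in> T" "g t = g u"
    moreover from this have "cos t = cos u"
      by (simp add: g_def vec_eq_iff forall_3)
    ultimately show "t = u"
      using pi_gt3 by (intro cos_inj_pi[of t u]) (auto simp: T_def)
  qed
  then have "infinite (g ` T)"
    using b(1) by (simp add: finite_image_iff T_def)
  then have "infinite (g ` T - X)"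
    using assms(2) by simp
  then obtain R where R: "finite R" "card R = r" "R \<subseteq> g ` T - X"
    using infinite_arbitrarily_large by blast
  show thesis
  proof (rule that[of R])
    show "R \<subseteq> sphere 0 1"
    proof
      fix x assume "x \<in> R"
      then obtain t where "x = g t" using R by auto
      then have "x \<bullet> x = 1"
        by (simp add: g_inner) (simp add: g_def flip: power2_eq_square)
      then show "x \<in> sphere 0 1" by (simp add: norm_eq_1)
    qed
    show "\<bar>x \<bullet> v i\<bar> \<le> f i" if "x \<in> R" "i \<in> F" for x i
      using that R b(2) by (auto simp: T_def less_imp_le subset_iff)
  qed (use R in auto)
qed

context ring_configuration
begin

lemma points_sphere: "x \<in> points \<Longrightarrow> x \<bullet> x = 1"
  using pt_sphere by (auto simp: points_def)

lemma points_subset_sphere: "points \<subseteq> sphere 0 1"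
  using points_sphere by (auto simp: norm_eq_1)

lemma lateral_edge_cases:
  assumes "(a, b) \<in> lateral_edges"
  obtains (ring) j k e \<sigma> \<eta> where "a = pt j k \<sigma>" "b = pt j (k + e) (\<eta> * \<sigma>)" "j \<le> s"
      "e \<in> {-1, 0, 1}" "\<sigma> \<in> {1, -1}" "\<eta> = 1 \<or> \<eta> = -1 \<and> j = s"
  | (child) j k e \<sigma> where "a = pt j k \<sigma>" "b = pt (Suc j) (2 * k + e) \<sigma>" "Suc j \<le> s"
      "e \<in> {-1, 0, 1, 2}" "\<sigma> \<in> {1, -1}"
  | (parent) j k e \<sigma> where "b = pt j k \<sigma>" "a = pt (Suc j) (2 * k + e) \<sigma>" "Suc j \<le> s"
      "e \<in> {-1, 0, 1, 2}" "\<sigma> \<in> {1, -1}"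
proof -
  consider "(a, b) \<in> edges {..s} 0 {-1, 0, 1} 1" | "(a, b) \<in> edges {s} 0 {-1, 0, 1} (-1)"
    | "(a, b) \<in> edges {..<s} 1 {-1, 0, 1, 2} 1" | "(b, a) \<in> edges {..<s} 1 {-1, 0, 1, 2} 1"
    using assms by (auto simp: lateral_edges_def)
  then show thesis
  proof cases
    case 1
    then show ?thesis by (rule in_edges, intro ring[where \<eta> = 1]) simp_all
  next
    case 2
    then show ?thesis by (rule in_edges, intro ring[where \<eta> = "-1"]) simp_all
  next
    case 3
    then show ?thesis by (rule in_edges, intro child) (simp_all add: Suc_le_eq)
  next
    case 4
    then show ?thesis by (rule in_edges, intro parent) (simp_all add: Suc_le_eq)
  qed
qed

lemma lateral_edge_in_points:
  assumes "(a, b) \<in> lateral_edges"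
  shows "a \<in> points" "b \<in> points"
  using assms by (auto elim!: lateral_edge_cases intro!: pt_in_points)

lemma lateral_edge_gabriel:
  assumes "(a, b) \<in> lateral_edges"
  shows "gabriel points a b"
  using assms
proof (cases rule: lateral_edge_cases)
  case (ring j k e \<sigma> \<eta>)
  have "gabriel points (pt j l \<sigma>') (pt j (l + 1) (\<eta> * \<sigma>'))" if "\<sigma>' \<in> {1, -1}" for l \<sigma>'
    using gabriel_ring[of j \<sigma>' l] gabriel_equator_diag[of \<sigma>' l] ring that by auto
  note step = this
  consider "e = 0" | "e = 1" | "e = -1" using ring by auto
  then show ?thesis
  proof cases
    case 1
    then show ?thesis
      using gabriel_refl[of j \<sigma> k] gabriel_equator_straight[of \<sigma> k] ring by auto
  next
    case 2
    then show ?thesis using step[of \<sigma> k] ring by simp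
  next
    case 3
    then have "gabriel points b a"
      using step[of "\<eta> * \<sigma>" "k - 1"] ring by auto
    then show ?thesis by (simp add: gabriel_commute)
  qed
next
  case (child j k e \<sigma>)
  then show ?thesis using gabriel_child by simp
next
  case (parent j k e \<sigma>)
  then have "gabriel points b a" using gabriel_child by simp
  then show ?thesis by (rule gabriel_commute[THEN iffD1])
qed

text \<open>Negation preserves the ring and shifts the index by half the ring size, at least 2,
  whereas offsets within a ring are at most 1 in absolute value.\<close>

lemma lateral_edge_neq:
  assumes "(a, b) \<in> lateral_edges"
  shows "b \<noteq> - a"
  using assms
proof (cases rule: lateral_edge_cases)
  case (ring j k e \<sigma> \<eta>)
  show ?thesis
  proof
    assume "b = - a"
    then have "pt j (k + e) (\<eta> * \<sigma>) = pt j (k + int h * 2 ^ j) (- \<sigma>)"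
      using ring uminus_pt by simp
    moreover have "\<eta> * \<sigma> \<in> {1, -1}" "- \<sigma> \<in> {1, -1}" using ring by auto
    ultimately have "ring_size j dvd e - int h * 2 ^ j"
      using ring pt_eq_iff[of j j "\<eta> * \<sigma>" "- \<sigma>" "k + e" "k + int h * 2 ^ j"] by simp
    then have dvd: "ring_size j dvd int h * 2 ^ j - e"
      by (simp add: dvd_diff_commute)
    have "ring_size j = 2 * (int h * 2 ^ j)"
      by (simp add: ring_size_def)
    then show False
      using zdvd_imp_le[OF dvd] ring_size_ge[of j] ring(4) by auto
  qed
next
  case (child j k e \<sigma>)
  have "pt (Suc j) (2 * k + e) \<sigma> \<noteq> pt j (k + int h * 2 ^ j) (- \<sigma>)"
    using child pt_eq_iff[of "Suc j" j \<sigma> "- \<sigma>"] by auto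
  then show ?thesis using child by (simp add: uminus_pt)
next
  case (parent j k e \<sigma>)
  have "pt (Suc j) (2 * k + e) \<sigma> \<noteq> pt j (k + int h * 2 ^ j) (- \<sigma>)"
    using parent pt_eq_iff[of "Suc j" j \<sigma> "- \<sigma>"] by auto
  then have "a \<noteq> - b" using parent by (simp add: uminus_pt)
  then show ?thesis by auto
qed

text \<open>The azimuths differ by at most a right angle, so the horizontal part of
  \<open>a \<bullet> b\<close> is nonnegative. For the heights u, v the claim follows from (1 - u)(1
  - v) > 0 and (1 + u)(1 + v) > 0.\<close>

lemma lateral_edge_pole:
  assumes "(a, b) \<in> lateral_edges"
  shows "\<bar>(a + b) $ 3\<bar> < 1 + a \<bullet> b"
proof -
  have *: "\<bar>(pt i k \<sigma> + pt j l \<tau>) $ 3\<bar> < 1 + pt i k \<sigma> \<bullet> pt j l \<tau>"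
    if "\<bar>ang i k - ang j l\<bar> \<le> pi / 2" "i \<le> s" "j \<le> s" "\<sigma> \<in> {1, -1}" "\<tau> \<in> {1, -1}" for i j k l \<sigma> \<tau>
  proof -
    have "\<bar>\<sigma> * ht i\<bar> < 1" "\<bar>\<tau> * ht j\<bar> < 1"
      using that ht_pos[of i] ht_pos[of j] ht_less_1[of i] ht_less_1[of j] by auto
    then have "0 < (1 - \<sigma> * ht i) * (1 - \<tau> * ht j)" "0 < (1 + \<sigma> * ht i) * (1 + \<tau> * ht j)"
      by (auto simp: abs_less_iff)
    moreover have "0 \<le> rad i * rad j * cos (ang i k - ang j l)"
    proof (intro mult_nonneg_nonneg cos_ge_zero)
      show "- (pi / 2) \<le> ang i k - ang j l" "ang i k - ang j l \<le> pi / 2"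
        using that(1) by linarith+
    qed (auto intro: less_imp_le rad_pos)
    ultimately show ?thesis
      unfolding pt_inner by (simp add: pt_def abs_less_iff algebra_simps)
  qed
  from assms show ?thesis
  proof (cases rule: lateral_edge_cases)
    case (ring j k e \<sigma> \<eta>)
    have "ang j k - ang j (k + e) = - (2 * of_int e * \<theta> j)"
      by (simp add: ang_def algebra_simps)
    then have "\<bar>ang j k - ang j (k + e)\<bar> \<le> pi / 2"
      using ring(4) \<theta>_le[of j] \<theta>_pos[of j] by auto
    then show ?thesis using *[of j k j "k + e" \<sigma> "\<eta> * \<sigma>"] ring by auto
  next
    case (child j k e \<sigma>)
    have "ang j k - ang (Suc j) (2 * k + e) = (1 - 2 * of_int e) * \<theta> (Suc j)"
      by (simp add: ang_def \<theta>_Suc[of j] algebra_simps)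
    then have "\<bar>ang j k - ang (Suc j) (2 * k + e)\<bar> \<le> pi / 2"
      using child(4) \<theta>_le[of j] \<theta>_Suc[of j] \<theta>_pos[of j] by auto
    then show ?thesis using *[of j k "Suc j" "2 * k + e" \<sigma> \<sigma>] child by auto
  next
    case (parent j k e \<sigma>)
    have "ang j k - ang (Suc j) (2 * k + e) = (1 - 2 * of_int e) * \<theta> (Suc j)"
      by (simp add: ang_def \<theta>_Suc[of j] algebra_simps)
    then have "\<bar>ang j k - ang (Suc j) (2 * k + e)\<bar> \<le> pi / 2"
      using parent(4) \<theta>_le[of j] \<theta>_Suc[of j] \<theta>_pos[of j] by auto
    then show ?thesis
      using *[of j k "Suc j" "2 * k + e" \<sigma> \<sigma>] parent by (auto simp: add.commute inner_commute)
  qed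
qed

lemma gabriel_iff_abs: "gabriel points a b \<longleftrightarrow> (\<forall>x\<in>points. \<bar>x \<bullet> (a + b)\<bar> \<le> 1 + a \<bullet> b)"
proof
  assume g: "gabriel points a b"
  show "\<forall>x\<in>points. \<bar>x \<bullet> (a + b)\<bar> \<le> 1 + a \<bullet> b"
  proof
    fix x assume "x \<in> points"
    then have "x \<bullet> (a + b) \<le> 1 + a \<bullet> b" "(- x) \<bullet> (a + b) \<le> 1 + a \<bullet> b"
      using g uminus_points unfolding gabriel_def by blast+
    then show "\<bar>x \<bullet> (a + b)\<bar> \<le> 1 + a \<bullet> b" by (simp add: abs_le_iff)
  qed
qed (auto simp: gabriel_def abs_le_iff)

lemma lateral_edges_subset_normal_rel:
  assumes "\<And>x a b. x \<in> R \<Longrightarrow> (a, b) \<in> lateral_edges \<Longrightarrow> \<bar>x \<bullet> (a + b)\<bar> \<le> 1 + a \<bullet> b"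
  shows "(\<lambda>(a, b). (a, - b)) ` lateral_edges \<subseteq> normal_rel (points \<union> R)"
proof safe
  fix a b assume ab: "(a, b) \<in> lateral_edges"
  note points = lateral_edge_in_points[OF ab]
  have "points \<union> R \<subseteq> closed_strip a (- b)"
    using assms ab lateral_edge_gabriel[OF ab] points_sphere points
    by (subst subset_closed_strip_iff) (auto simp: gabriel_iff_abs)
  moreover have "a \<noteq> - b"
    using lateral_edge_neq[OF ab] by auto
  ultimately show "(a, - b) \<in> normal_rel (points \<union> R)"
    using points uminus_points by (auto simp: normal_rel_def)
qed

text \<open>The \<open>r\<close> extra points are taken so close to the pole that every lateral edge
  still gives a double-normal pair of the enlarged set.\<close>

lemma exists_lower_bound:
  obtains V where "V \<subseteq> sphere 0 1" "finite V" "int (card V) = 4 * int h * (2 ^ Suc s - 1) + int r"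
    "int h * (34 * 2 ^ s - 22) \<le> int (num_double_normal_pairs V)"
proof -
  obtain R where R: "R \<subseteq> sphere 0 1" "finite R" "card R = r" "R \<inter> points = {}"
    and near: "\<And>x p. x \<in> R \<Longrightarrow> p \<in> lateral_edges
      \<Longrightarrow> \<bar>x \<bullet> (fst p + snd p)\<bar> \<le> 1 + fst p \<bullet> snd p"
    using sphere_points_near_pole[of lateral_edges points "\<lambda>p. fst p + snd p" "\<lambda>p. 1 + fst p \<bullet> snd p" r]
      card_lateral_edges(1) finite_points lateral_edge_pole by (metis prod.collapse)
  have R': "\<bar>x \<bullet> (a + b)\<bar> \<le> 1 + a \<bullet> b" if "x \<in> R" "(a, b) \<in> lateral_edges" for x a b
    using near[OF that] by simp
  show thesis
  proof (rule that[of "points \<union> R"])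
    show "int (card (points \<union> R)) = 4 * int h * (2 ^ Suc s - 1) + int r"
      using R finite_points card_points by (subst card_Un_disjoint) auto
    have "card lateral_edges = card ((\<lambda>(a, b). (a, - b)) ` lateral_edges)"
      by (rule card_image[symmetric]) (auto intro: inj_onI)
    also have "\<dots> \<le> card (normal_rel (points \<union> R))"
    proof (rule card_mono[OF _ lateral_edges_subset_normal_rel[OF R']])
      show "finite (normal_rel (points \<union> R))"
        by (rule finite_subset[of _ "(points \<union> R) \<times> (points \<union> R)"])
          (use R finite_points in \<open>auto simp: normal_rel_def\<close>)
    qed
    also have "\<dots> = 2 * num_double_normal_pairs (points \<union> R)"
      using R finite_points by (intro card_normal_rel) auto
    finally have "int (card lateral_edges) \<le> 2 * int (num_double_normal_pairs (points \<union> R))"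
      by simp
    then show "int h * (34 * 2 ^ s - 22) \<le> int (num_double_normal_pairs (points \<union> R))"
      by (simp add: card_lateral_edges)
  qed (use R points_subset_sphere finite_points in auto)
qed

end

lemma exists_sphere_set_many_double_normals:
  fixes n :: nat
  assumes "n \<ge> 64"
  obtains V :: "(real^3) set" where "V \<subseteq> sphere 0 1" "finite V" "card V = n"
    "real (num_double_normal_pairs V) \<ge> 17 / 4 * real n - 22 * sqrt (real n)"
proof -
  obtain s h r M :: nat where *: "M = 2 ^ Suc s" "2 \<le> h" "n = 4 * h * (M - 1) + r" "r < 4 * (M - 1)"
    "real M \<le> sqrt n" "real h \<le> sqrt n"
    using nat_decompose_by_power_of_two[OF assms] .
  interpret ring_configuration h s by unfold_locales (rule *)
  have M: "1 \<le> M" using * by simp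
  obtain V where V: "V \<subseteq> sphere 0 1" "finite V" "int (card V) = 4 * int h * (2 ^ Suc s - 1) + int r"
    "int h * (34 * 2 ^ s - 22) \<le> int (num_double_normal_pairs V)"
    using exists_lower_bound .
  have "int (card V) = int n"
    using V(3) M unfolding *(3) by (simp add: *(1) of_nat_diff)
  then have "card V = n" by simp
  moreover have "17 / 4 * real n - 22 * sqrt (real n) \<le> real (num_double_normal_pairs V)"
  proof -
    have "real h * (17 * real M - 22) = real_of_int (int h * (34 * 2 ^ s - 22))"
      by (simp add: *(1))
    also have "\<dots> \<le> real (num_double_normal_pairs V)"
      using V(4) by linarith
    finally have "real h * (17 * real M - 22) \<le> real (num_double_normal_pairs V)" .
    moreover have "real n = 4 * real h * (real M - 1) + real r"
      using M unfolding *(3) by (simp add: of_nat_diff)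
    moreover have "real r \<le> 4 * real M"
      using *(4) by linarith
    \<comment> \<open>The loss relative to \<open>17 / 4 * n\<close> is at most
      \<open>5 * h + 17 * M\<close>, whence the constant 22 = 5 + 17.\<close>
    ultimately show ?thesis
      using *(5,6) by (simp add: algebra_simps)
  qed
  ultimately show thesis using that V by blast
qed

context ring_configuration
begin

subsection \<open>Exactness for the square\<close>

text \<open>Rounding the angular distance in full turns gives the number of periods to remove from
  the index.\<close>

lemma pt_normalise:
  obtains l' :: int where "pt j l' \<tau> = pt j l \<tau>" "\<bar>ang j l' - x\<bar> \<le> pi"
proof
  define m where "m = round ((ang j l - x) / (2 * pi))"
  have "ang j (l + (- m) * ring_size j) = ang j l - 2 * of_int m * (ring_size j * \<theta> j)"
    by (simp add: ang_def algebra_simps)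
  then have ang: "ang j (l + (- m) * ring_size j) = ang j l - 2 * pi * of_int m"
    by (simp add: ring_size_\<theta>)
  have "\<bar>of_int m - (ang j l - x) / (2 * pi)\<bar> \<le> 1 / 2"
    unfolding m_def by (rule of_int_round_abs_le)
  then have "2 * pi * \<bar>of_int m - (ang j l - x) / (2 * pi)\<bar> \<le> 2 * pi * (1 / 2)"
    by (intro mult_left_mono) auto
  moreover have "2 * pi * \<bar>of_int m - (ang j l - x) / (2 * pi)\<bar>
      = \<bar>2 * pi * (of_int m - (ang j l - x) / (2 * pi))\<bar>"
    by (simp add: abs_mult)
  moreover have "2 * pi * (of_int m - (ang j l - x) / (2 * pi)) = 2 * pi * of_int m - (ang j l - x)"
    by (simp add: field_simps)
  ultimately show "\<bar>ang j (l + (- m) * ring_size j) - x\<bar> \<le> pi"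
    unfolding ang by linarith
  show "pt j (l + (- m) * ring_size j) \<tau> = pt j l \<tau>"
    by (rule pt_periodic)
qed

lemma in_edgesI:
  assumes "j \<in> J" "e \<in> E" "\<sigma> \<in> {1, -1}"
  shows "(pt j k \<sigma>, pt (j + \<delta>) (2 ^ \<delta> * k + e) (\<eta> * \<sigma>)) \<in> edges J \<delta> E \<eta>"
  using assms by (auto simp: edges_def)

text \<open>Turns the angle bounds of \<open>gabriel_cases\<close> into index offsets. The conjunct
  \<open>i = j\<close> serves when the endpoints are exchanged: for endpoints on different rings
  only the last family remains.\<close>

lemma gabriel_imp_edge:
  assumes h: "h = 2" and g: "gabriel points (pt i k \<sigma>) (pt j l \<tau>)" and "i \<le> j" "j \<le> s"
    and sg: "\<sigma> \<in> {1, -1}" "\<tau> \<in> {1, -1}" and ne: "pt j l \<tau> \<noteq> - pt i k \<sigma>"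
  defines "P \<equiv> (pt i k \<sigma>, pt j l \<tau>)"
  shows "(i = j \<and> P \<in> edges {..s} 0 {-1, 0, 1} 1 \<union> edges {s} 0 {-1, 0, 1} (-1) \<union> edges {0} 0 {2} 1)
    \<or> P \<in> edges {..<s} 1 {-1, 0, 1, 2} 1"
proof -
  obtain l' where l': "pt j l' \<tau> = pt j l \<tau>" "\<bar>ang j l' - ang i k\<bar> \<le> pi"
    by (rule pt_normalise)
  have P: "P = (pt i k \<sigma>, pt j l' \<tau>)" by (simp add: P_def l')
  have same: "\<bar>ang j l' - ang i k\<bar> = 2 * of_int \<bar>l' - k\<bar> * \<theta> j" if "i = j"
  proof -
    have "ang j l' - ang i k = 2 * (of_int (l' - k) * \<theta> j)"
      by (simp add: that ang_def algebra_simps)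
    then show ?thesis
      using \<theta>_pos[of j] by (simp add: abs_mult)
  qed
  have near: "l' - k \<in> {-1, 0, 1}" if "i = j" "\<bar>ang j l' - ang i k\<bar> \<le> 2 * \<theta> j"
  proof -
    have "of_int \<bar>l' - k\<bar> * \<theta> j \<le> 1 * \<theta> j" using that same by simp
    then have "of_int \<bar>l' - k\<bar> \<le> (1 :: real)"
      using \<theta>_pos[of j] by (simp only: mult_le_cancel_right_pos)
    then have "\<bar>l' - k\<bar> \<le> 1" by linarith
    then show ?thesis by auto
  qed
  consider
      (ring) "i = j" "\<tau> = \<sigma>" "\<bar>ang j l' - ang i k\<bar> \<le> 2 * \<theta> j"
    | (child) "j = Suc i" "\<tau> = \<sigma>" "\<bar>ang j l' - ang i k\<bar> \<le> 3 * \<theta> j"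
    | (equator) "i = s" "j = s" "\<tau> = - \<sigma>" "\<bar>ang j l' - ang i k\<bar> \<le> 2 * \<theta> j"
    | (top) "i = 0" "j = 0" "\<tau> = \<sigma>" "\<bar>ang j l' - ang i k\<bar> = pi"
    using gabriel_cases[of i k \<sigma> j l' \<tau>] assms l' by auto
  then show ?thesis
  proof cases
    case ring
    then show ?thesis
      using in_edgesI[of j "{..s}" "l' - k" "{-1, 0, 1}" \<sigma> k 0 1] near sg \<open>j \<le> s\<close> by (simp add: P)
  next
    case equator
    then show ?thesis
      using in_edgesI[of j "{s}" "l' - k" "{-1, 0, 1}" \<sigma> k 0 "-1"] near sg by (simp add: P)
  next
    case child
    have "ang j l' - ang i k = of_int (2 * (l' - 2 * k) - 1) * \<theta> j"
      using ang_diff[of i j l' k] child by (simp add: algebra_simps)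
    then have "of_int \<bar>2 * (l' - 2 * k) - 1\<bar> * \<theta> j \<le> 3 * \<theta> j"
      using child(3) \<theta>_pos[of j] by (simp add: abs_mult)
    then have "of_int \<bar>2 * (l' - 2 * k) - 1\<bar> \<le> (3 :: real)"
      using \<theta>_pos[of j] by (simp only: mult_le_cancel_right_pos)
    then have "\<bar>2 * (l' - 2 * k) - 1\<bar> \<le> 3" by linarith
    \<comment> \<open>The odd numbers of absolute value at most 3 correspond exactly to the four
      offsets.\<close>
    then have "l' - 2 * k \<in> {-1, 0, 1, 2}" by auto
    then show ?thesis
      using in_edgesI[of i "{..<s}" "l' - 2 * k" "{-1, 0, 1, 2}" \<sigma> k 1 1] child sg \<open>j \<le> s\<close>
      by (simp add: P)
  next
    case top
    have size: "ring_size 0 = 4"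
      unfolding ring_size_def using h by simp
    have "2 * of_int \<bar>l' - k\<bar> * \<theta> 0 = 4 * \<theta> 0"
      using same top ring_size_\<theta>[of 0] size by simp
    then have "of_int \<bar>l' - k\<bar> = (2 :: real)"
      using \<theta>_pos[of 0] by simp
    then have "\<bar>l' - k\<bar> = 2" by linarith
    then have "4 dvd l' - (k + 2)" by presburger
    then have "pt 0 l' \<sigma> = pt 0 (k + 2) \<sigma>"
      by (intro pt_cong) (simp only: size)
    then show ?thesis
      using in_edgesI[of 0 "{0}" 2 "{2}" \<sigma> k 0 1] top sg by (simp add: P)
  qed
qed

text \<open>Offset 2 differs from -1, 0 and 1 modulo the size of ring 0, which is at least
  4.\<close>

lemma top_edges_disjoint: "lateral_edges \<inter> edges {0} 0 {2} 1 = {}"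
proof -
  have "(a, b) \<notin> edges {..s} 0 {-1, 0, 1} 1" if "(a, b) \<in> edges {0} 0 {2} 1" for a b
  proof
    assume "(a, b) \<in> edges {..s} 0 {-1, 0, 1} 1"
    then obtain j k e \<sigma> where 1: "a = pt j k \<sigma>" "b = pt j (k + e) \<sigma>" "j \<le> s" "e \<in> {-1, 0, 1}"
      "\<sigma> \<in> {1, -1}"
      by (rule in_edges) simp
    obtain k' \<sigma>' where 2: "a = pt 0 k' \<sigma>'" "b = pt 0 (k' + 2) \<sigma>'" "\<sigma>' \<in> {1, -1}"
      using \<open>(a, b) \<in> edges {0} 0 {2} 1\<close> by (rule in_edges) simp
    have "pt j k \<sigma> = pt 0 k' \<sigma>'" "pt j (k + e) \<sigma> = pt 0 (k' + 2) \<sigma>'"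
      using 1 2 by simp_all
    then have "ring_size 0 dvd k - k'" "ring_size 0 dvd (k + e) - (k' + 2)"
      using 1(3,5) 2(3) pt_eq_iff[of j 0 \<sigma> \<sigma>'] by simp_all
    then have "ring_size 0 dvd (k - k') - ((k + e) - (k' + 2))"
      by (rule dvd_diff)
    then have "ring_size 0 dvd 2 - e" by simp
    then show False
      using zdvd_imp_le[of "ring_size 0" "2 - e"] ring_size_ge[of 0] 1(4) by auto
  qed
  then have "edges {..s} 0 {-1, 0, 1} 1 \<inter> edges {0} 0 {2} 1 = {}" by auto
  moreover have "edges {0} 0 {2} 1 \<inter> edges {s} 0 {-1, 0, 1} (-1) = {}"
    "edges {0} 0 {2} 1 \<inter> edges {..<s} 1 {-1, 0, 1, 2} 1 = {}"
    by (intro edges_disjoint; auto)+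
  moreover have "edges {0} 0 {2} 1 \<inter> prod.swap ` edges {..<s} 1 {-1, 0, 1, 2} 1 = {}"
    using edges_swap_disjoint[of "{0}" 0 1 "{..<s}" 0 1] by simp
  ultimately show ?thesis
    unfolding lateral_edges_def by blast
qed

lemma normal_rel_points_eq:
  assumes h: "h = 2"
  shows "normal_rel points = (\<lambda>(a, b). (a, - b)) ` (lateral_edges \<union> edges {0} 0 {2} 1)"
proof
  show "normal_rel points \<subseteq> (\<lambda>(a, b). (a, - b)) ` (lateral_edges \<union> edges {0} 0 {2} 1)"
  proof safe
    fix p p' assume pp': "(p, p') \<in> normal_rel points"
    define b where "b = - p'"
    have b: "p \<in> points" "b \<in> points" "b \<noteq> - p" "p \<noteq> - b" "p' = - b"
      using pp' uminus_points by (auto simp: normal_rel_def b_def)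
    have "gabriel points p b"
      using pp' subset_closed_strip_iff[of p b points] points_sphere b
      by (auto simp: normal_rel_def gabriel_iff_abs)
    obtain i k \<sigma> where p: "p = pt i k \<sigma>" "i \<le> s" "\<sigma> \<in> {1, -1}"
      using b(1) by (auto simp: points_def)
    obtain j l \<tau> where q: "b = pt j l \<tau>" "j \<le> s" "\<tau> \<in> {1, -1}"
      using b(2) by (auto simp: points_def)
    have "(p, b) \<in> lateral_edges \<union> edges {0} 0 {2} 1"
    proof (cases "i \<le> j")
      case True
      then show ?thesis
        using gabriel_imp_edge[OF h, of i k \<sigma> j l \<tau>] \<open>gabriel points p b\<close> b p q
        by (auto simp: lateral_edges_def)
    next
      case False
      have "gabriel points b p"
        using \<open>gabriel points p b\<close> by (rule gabriel_commute[THEN iffD1])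
      then have "(b, p) \<in> edges {..<s} 1 {-1, 0, 1, 2} 1"
        using gabriel_imp_edge[OF h, of j l \<tau> i k \<sigma>] b p q False by auto
      then have "(p, b) \<in> prod.swap ` edges {..<s} 1 {-1, 0, 1, 2} 1"
        by (rule rev_image_eqI) simp
      then show ?thesis by (simp add: lateral_edges_def)
    qed
    then show "(p, p') \<in> (\<lambda>(a, b). (a, - b)) ` (lateral_edges \<union> edges {0} 0 {2} 1)"
      by (rule rev_image_eqI) (simp add: b)
  qed
  have "(a, - b) \<in> normal_rel points" if top: "(a, b) \<in> edges {0} 0 {2} 1" for a b
  proof -
    obtain k \<sigma> where ab: "a = pt 0 k \<sigma>" "b = pt 0 (k + 2) \<sigma>" "\<sigma> \<in> {1, -1}"
      using top by (rule in_edges) simp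
    have points: "a \<in> points" "b \<in> points" using ab pt_in_points by auto
    moreover have "points \<subseteq> closed_strip a (- b)"
      using gabriel_top[OF h, of \<sigma> k] ab points_sphere points
      by (subst subset_closed_strip_iff) (auto simp: gabriel_iff_abs)
    moreover have "a \<noteq> - b"
      using ab pt_eq_iff[of 0 0 \<sigma> "- \<sigma>"] by (auto simp: uminus_pt)
    ultimately show ?thesis
      using uminus_points by (auto simp: normal_rel_def)
  qed
  moreover have "(\<lambda>(a, b). (a, - b)) ` lateral_edges \<subseteq> normal_rel points"
    using lateral_edges_subset_normal_rel[of "{}"] by simp
  ultimately show "(\<lambda>(a, b). (a, - b)) ` (lateral_edges \<union> edges {0} 0 {2} 1) \<subseteq> normal_rel points"
    by auto
qed

text \<open>The two top squares add 8 ordered edges, one for each of their vertices, to the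
  \<open>4 * (34 * 2 ^ s - 22)\<close> lateral ones.\<close>

lemma num_double_normal_pairs_points:
  assumes h: "h = 2"
  shows "int (num_double_normal_pairs points) = 68 * 2 ^ s - 40"
proof -
  have top: "finite (edges {0} 0 {2} 1)" "int (card (edges {0} 0 {2} 1)) = 8"
    using card_edges[of "{0}" 0 "{2}" 1] ring_size_def[of 0] h by simp_all
  have "2 * num_double_normal_pairs points = card (lateral_edges \<union> edges {0} 0 {2} 1)"
    unfolding card_normal_rel[OF finite_points, symmetric] normal_rel_points_eq[OF h]
    by (rule card_image) (auto intro: inj_onI)
  also have "\<dots> = card lateral_edges + card (edges {0} 0 {2} 1)"
    using top card_lateral_edges(1) top_edges_disjoint by (intro card_Un_disjoint) auto
  finally have "2 * int (num_double_normal_pairs points) = int (card lateral_edges) + 8"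
    using top by simp
  moreover have "int (card lateral_edges) = 2 * 2 * (34 * 2 ^ s - 22)"
    using card_lateral_edges(2) h by simp
  ultimately show ?thesis by simp
qed

end

theorem theorem4:
  shows "(\<exists>C::real. C > 0 \<and> (\<exists>n0::nat. \<forall>n\<ge>n0. \<exists>V::(real^3) set.
            V \<subseteq> sphere 0 1 \<and> finite V \<and> card V = n \<and>
            real (num_double_normal_pairs V) \<ge> 17 / 4 * real n - C * sqrt (real n)))
       \<and> infinite {n::nat. \<exists>V::(real^3) set.
            V \<subseteq> sphere 0 1 \<and> finite V \<and> card V = n \<and>
            real (num_double_normal_pairs V) = 17 / 4 * real n - 6}"
    (is "_ \<and> infinite ?N")
proof
  show "\<exists>C::real. C > 0 \<and> (\<exists>n0::nat. \<forall>n\<ge>n0. \<exists>V::(real^3) set.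
            V \<subseteq> sphere 0 1 \<and> finite V \<and> card V = n \<and>
            real (num_double_normal_pairs V) \<ge> 17 / 4 * real n - C * sqrt (real n))"
    by (intro exI[of _ 22] conjI exI[of _ 64] allI impI) (simp, meson exists_sphere_set_many_double_normals)
  show "infinite ?N"
  proof -
    \<comment> \<open>The number of points for \<open>h = 2\<close>; it is strictly increasing in
      \<open>s\<close>, so infinitely many values arise.\<close>
    define f :: "nat \<Rightarrow> nat" where "f s = 8 * (2 ^ Suc s - 1)" for s
    have "f s \<in> ?N" for s
    proof -
      interpret ring_configuration 2 s by unfold_locales simp
      have card: "int (card points) = 16 * 2 ^ s - 8"
        using card_points by simp
      have "int (f s) = 16 * 2 ^ s - 8"
        by (simp add: f_def of_nat_diff)
      then have "card points = f s"
        using card by linarith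
      moreover have "real (num_double_normal_pairs points) = 17 / 4 * real (card points) - 6"
      proof -
        have "4 * int (num_double_normal_pairs points) = 17 * int (card points) - 24"
          using num_double_normal_pairs_points card by simp
        then show ?thesis by linarith
      qed
      ultimately show ?thesis
        using points_subset_sphere finite_points by auto
    qed
    then have "range f \<subseteq> ?N" by blast
    moreover have "inj f"
    proof (rule strict_mono_imp_inj_on, rule strict_monoI)
      fix m n :: nat assume "m < n"
      then have "(2::nat) ^ Suc m < 2 ^ Suc n" by (intro power_strict_increasing) auto
      moreover have "(1::nat) \<le> 2 ^ Suc m" by simp
      ultimately show "f m < f n" unfolding f_def by linarith
    qed
    ultimately show ?thesis
      using finite_subset range_inj_infinite by blast
  qed
qed

end
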